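(* Let $Y(0,1)$ be a rearrangement-invariant (r.i.) space with fundamental function $\varphi_Y$, and let $I\colon[0,1]\to[0,\infty)$ be a non-decreasing measurable function such that the function $(0,1)\ni t\mapsto\int_t^1\frac{1}{I(s)}\,\mathrm{d}s$ belongs to $Y(0,1)$. Assume that $$\lim_{t\to0^+}\varphi_Y(t)=0,$$ and that there is a constant $C>0$ such that $$\int_0^t\ \sup_{\tau\in(s,1)}\frac{\varphi_Y(\tau)}{I(\tau)}\,\mathrm{d}s\ \le\ C\,t\sup_{s\in(t,1)}\frac{\varphi_Y(\frac s2)}{s}\int_{\frac s2}^{s}\frac{\mathrm{d}\tau}{I(\tau)}\qquad\text{for every }t\in(0,1).$$ Define, for $f\in\mathcal M(0,1)$, $$\|f\|_{X(0,1)}=\sup_h\left\|\int_\tau^1\frac{h(s)}{I(s)}\,\mathrm{d}s\right\|_{Y(0,1)},$$ where the norm on the right is taken with respect to the variable $\tau\in(0,1)$ and the supremum is extended over all $h\in\mathcal M_+(0,1)$ such that $h^*=f^*$, and let $X(0,1)=\{f\in\mathcal M(0,1)\colon\|f\|_{X(0,1)}<\infty\}$. Then $X(0,1)$ is an r.i. space, and there are constants $c_1,c_2>0$ such that $$c_1\,t\sup_{s\in(t,1)}\frac{\varphi_Y(\frac s2)}{s}\int_{\frac s2}^{s}\frac{\mathrm{d}\tau}{I(\tau)}\ \le\ \varphi_X(t)\ \le\ c_2\,t\sup_{s\in(t,1)}\frac{\varphi_Y(\frac s2)}{s}\int_{\frac s2}^{s}\frac{\mathrm{d}\tau}{I(\tau)}\qquad\text{for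 every }t\in(0,1).$$
   Context: $\mathcal M(0,1)$ is the set of Lebesgue-measurable functions $f\colon(0,1)\to[-\infty,\infty]$ and $\mathcal M_+(0,1)$ the set of those that are nonnegative a.e. For $f\in\mathcal M(0,1)$ the non-increasing rearrangement is $f^*(t)=\inf\{s>0\colon|\{x\in(0,1)\colon|f(x)|>s\}|\le t\}$, $t\in[0,1]$. An r.i. function norm is a functional $\|\cdot\|_{X(0,1)}\colon\mathcal M_+(0,1)\to[0,\infty]$ such that for all $f,g,f_j\in\mathcal M_+(0,1)$ and $\lambda\ge0$: (P1) $\|f\|=0\iff f=0$ a.e., $\|\lambda f\|=\lambda\|f\|$, $\|f+g\|\le\|f\|+\|g\|$; (P2) $f\le g$ a.e. implies $\|f\|\le\|g\|$; (P3) $f_j\nearrow f$ a.e. implies $\|f_j\|\nearrow\|f\|$; (P4) $\|1\|<\infty$; (P5) $\int_0^1f\le c\|f\|$ with $c$ independent of $f$; (P6) $\|f\|=\|g\|$ whenever $f^*=g^*$. For $f\in\mathcal M(0,1)$ one sets $\|f\|_{X(0,1)}=\|f^*\|_{X(0,1)}$, and the r.i. space $X(0,1)$ is $\{f\in\mathcal M(0,1)\colon\|f\|_{X(0,1)}<\infty\}$. The fundamental function of an r.i. space $X$ is $\varphi_X(t)=\|\chi_E\|_{X}$, where $E\subset(0,1)$ is any measurable set with $|E|=t$, $t\in[0,1]$. *)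

theory Defs
  imports "HOL-Analysis.Analysis"
begin

text \<open>
  A function on \<open>(0,1)\<close> is represented by a function of type \<^typ>\<open>real \<Rightarrow> ereal\<close> whose values outside
  \<open>(0,1)\<close> are ignored: everything below refers to Lebesgue measure restricted to \<open>(0,1)\<close>.
\<close>

abbreviation leb01 :: "real measure" where
  "leb01 \<equiv> lebesgue_on {0<..<1}"

definition M01 :: "(real \<Rightarrow> ereal) set" where
  "M01 = borel_measurable leb01"

definition M01_plus :: "(real \<Rightarrow> ereal) set" where
  "M01_plus = {f \<in> M01. AE x in leb01. 0 \<le> f x}"

text \<open>The infimum is taken in the extended reals, so that it is \<open>\<infinity>\<close> for the empty set.\<close>

definition rearr :: "(real \<Rightarrow> ereal) \<Rightarrow> real \<Rightarrow> ereal" where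
  "rearr f t = (INF s \<in> {s::real. 0 < s \<and> measure leb01 {x \<in> {0<..<1}. ereal s < \<bar>f x\<bar>} \<le> t}. ereal s)"

definition same_rearr :: "(real \<Rightarrow> ereal) \<Rightarrow> (real \<Rightarrow> ereal) \<Rightarrow> bool" where
  "same_rearr f g \<longleftrightarrow> (\<forall>t\<in>{0..1}. rearr f t = rearr g t)"

text \<open>
  In (P1), sums of the form \<open>\<infinity> + (-\<infinity>)\<close> can only occur on a null set, and \<open>0 \<cdot> \<infinity> = 0\<close>.
\<close>

locale ri_function_norm =
  fixes N :: "(real \<Rightarrow> ereal) \<Rightarrow> ennreal"
  assumes P1_zero: "f \<in> M01_plus \<Longrightarrow> N f = 0 \<longleftrightarrow> (AE x in leb01. f x = 0)"
    and P1_scale: "f \<in> M01_plus \<Longrightarrow> 0 \<le> c \<Longrightarrow> N (\<lambda>x. ereal c * f x) = ennreal c * N f"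
    and P1_triangle: "f \<in> M01_plus \<Longrightarrow> g \<in> M01_plus \<Longrightarrow> N (\<lambda>x. f x + g x) \<le> N f + N g"
    and P2: "f \<in> M01_plus \<Longrightarrow> g \<in> M01_plus \<Longrightarrow> AE x in leb01. f x \<le> g x \<Longrightarrow> N f \<le> N g"
    and P3: "(\<And>j::nat. F j \<in> M01_plus) \<Longrightarrow> f \<in> M01_plus \<Longrightarrow>
      AE x in leb01. incseq (\<lambda>j. F j x) \<and> (\<lambda>j. F j x) \<longlonglongrightarrow> f x \<Longrightarrow>
      incseq (\<lambda>j. N (F j)) \<and> (\<lambda>j. N (F j)) \<longlonglongrightarrow> N f"
    and P4: "N (\<lambda>x. 1) < \<infinity>"
    and P5: "\<exists>c::real. 0 < c \<and>
      (\<forall>f\<in>M01_plus. (\<integral>\<^sup>+ x. e2ennreal (f x) \<partial>leb01) \<le> ennreal c * N f)"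
    and P6: "f \<in> M01_plus \<Longrightarrow> g \<in> M01_plus \<Longrightarrow> same_rearr f g \<Longrightarrow> N f = N g"

text \<open>
  An r.i. space is given together with its norm, the latter being already extended from the
  nonnegative functions to all measurable ones by \<open>\<parallel>f\<parallel> = \<parallel>f\<^sup>*\<parallel>\<close>.
\<close>

definition ri_space :: "(real \<Rightarrow> ereal) set \<Rightarrow> ((real \<Rightarrow> ereal) \<Rightarrow> ennreal) \<Rightarrow> bool" where
  "ri_space X N \<longleftrightarrow> ri_function_norm N \<and> (\<forall>f\<in>M01. N f = N (rearr f)) \<and> X = {f \<in> M01. N f < \<infinity>}"

text \<open>
  The choice of the set is immaterial for an r.i. function norm, see
  \<open>ri_function_norm.fundamental_function_eq\<close> below.
\<close>

definition fundamental_function :: "((real \<Rightarrow> ereal) \<Rightarrow> ennreal) \<Rightarrow> real \<Rightarrow> ennreal" where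
  "fundamental_function N t = N (indicator (SOME E. E \<in> sets leb01 \<and> measure leb01 E = t))"

lemma rearr_indicator_cong:
  assumes "E \<in> sets leb01" "E' \<in> sets leb01" "measure leb01 E = measure leb01 E'"
  shows "rearr (indicator E) = rearr (indicator E')"
proof -
  have *: "{x \<in> {0<..<1}. ereal s < \<bar>indicator A x :: ereal\<bar>} = (if s < 1 then A else {})"
    if "0 < s" "A \<in> sets leb01" for s A
    using that sets.sets_into_space[OF that(2)]
    by (auto simp: indicator_def one_ereal_def split: if_splits)
  have "{s::real. 0 < s \<and> measure leb01 {x \<in> {0<..<1}. ereal s < \<bar>indicator E x :: ereal\<bar>} \<le> t} =
        {s::real. 0 < s \<and> measure leb01 {x \<in> {0<..<1}. ereal s < \<bar>indicator E' x :: ereal\<bar>} \<le> t}" for t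
    using assms by (intro Collect_cong conj_cong refl) (simp only: *, simp)
  then show ?thesis
    unfolding rearr_def by simp
qed

lemma (in ri_function_norm) fundamental_function_eq:
  assumes "E \<in> sets leb01" "measure leb01 E = t"
  shows "fundamental_function N t = N (indicator E)"
proof -
  define E' where "E' = (SOME E. E \<in> sets leb01 \<and> measure leb01 E = t)"
  have E': "E' \<in> sets leb01 \<and> measure leb01 E' = t"
    unfolding E'_def by (rule someI[of _ E]) (use assms in auto)
  have "indicator A \<in> M01_plus" if "A \<in> sets leb01" for A
    using that unfolding M01_plus_def M01_def by (auto simp: indicator_def)
  then have "N (indicator E') = N (indicator E)"
    using assms E' by (intro P6) (auto simp: same_rearr_def rearr_indicator_cong[of E' E])
  then show ?thesis
    unfolding fundamental_function_def E'_def .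
qed

text \<open>Division is that of \<^typ>\<open>ennreal\<close>: \<open>a / 0 = \<infinity>\<close> for \<open>a > 0\<close> and \<open>0 / 0 = 0\<close>.\<close>

definition tail_integral :: "(real \<Rightarrow> real) \<Rightarrow> (real \<Rightarrow> ereal) \<Rightarrow> real \<Rightarrow> ereal" where
  "tail_integral I h \<tau> =
    enn2ereal (\<integral>\<^sup>+ s\<in>{\<tau><..<1}. e2ennreal (h s) / ennreal (I s) \<partial>lebesgue)"

definition X_norm ::
    "((real \<Rightarrow> ereal) \<Rightarrow> ennreal) \<Rightarrow> (real \<Rightarrow> real) \<Rightarrow> (real \<Rightarrow> ereal) \<Rightarrow> ennreal" where
  "X_norm NY I f = (SUP h \<in> {h \<in> M01_plus. same_rearr h f}. NY (tail_integral I h))"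

end

theory Submission
  imports Defs
begin

text \<open>
  On a nonnegative function \<open>f\<close> the norm of \<open>X\<close> is the supremum of \<open>\<parallel>\<integral>\<^bsub>\<tau>\<^esub>\<^bsup>1\<^esup> f(\<theta>(s))/I(s) ds\<parallel>\<close> in \<open>Y\<close> over all
  measure-preserving maps \<open>\<theta>\<close> of \<open>(0,1)\<close>: if \<open>h\<^sup>* = f\<^sup>*\<close> then for every \<open>b > 1\<close> some \<open>\<theta>\<close> satisfies
  \<open>h \<le> b f \<circ> \<theta>\<close> almost everywhere. Composition with a fixed \<open>\<theta>\<close> preserves sums, order and monotone limits, so
  the axioms of an r.i. norm pass from \<open>Y\<close> to \<open>X\<close>.

  For the upper bound on the fundamental function, Minkowski's integral inequality gives
  \<open>\<parallel>\<integral>\<^bsub>\<tau>\<^esub>\<^bsup>1\<^esup> \<chi>\<^bsub>F\<^esub>/I\<parallel> \<le> \<integral>\<^bsub>F\<^esub> \<phi>/I\<close> in \<open>Y\<close>, and \<open>\<phi>/I\<close> is dominated almost everywhere by the non-increasing function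
  \<open>s \<mapsto> sup {\<phi>(\<tau>)/I(\<tau>) | \<tau> > s}\<close>, whose integral over a set of measure \<open>t\<close> is at most that over \<open>(0,t)\<close>. For the lower
  bound, test with the indicator of \<open>(a,a+t)\<close>, \<open>a = min (s/2) (s-t)\<close>.
\<close>

subsection \<open>Measure-preserving transport\<close>

text \<open>Read off the definition of the X norm, the triangle inequality would require splitting
  each function equimeasurable with f + g into summands equimeasurable with f and with g.
  Composition with one map \<theta> does the splitting by itself, which is why the norm is rewritten
  in terms of maps. The price is that equimeasurable functions must be matched by maps, and an exact
  match can fail: if f(x) is the fractional part of 2x and h(x) = x, then h = f(\<theta>) forces
  \<theta>(x) to be x/2 or (x+1)/2, and no such map preserves measure. A match does exist for
  functions with countably many values, so values are recorded only up to the cell [b^n, b^(n+1))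
  containing them. This costs a factor b, and b tends to 1 at the end. Among the axioms, P4 is
  exactly the assumption on the integral of 1/I, and P5 rests on 1/I being bounded below, because I
  is at most I(1). Both estimates of the fundamental function lose little: the constants are c1 = 1
  and c2 = C.\<close>

lemma cumulative_continuous:
  fixes E :: "real set"
  assumes "E \<in> sets lebesgue"
  shows "continuous_on UNIV (\<lambda>y. measure lebesgue (E \<inter> {0..y}))"
proof (rule lipschitz_on_continuous_on)
  have fm: "E \<inter> {0..y} \<in> fmeasurable lebesgue" for y
    by (rule fmeasurableI2[of "{0..y}"]) (use assms in auto)
  have *: "measure lebesgue (E \<inter> {0..y}) \<le> measure lebesgue (E \<inter> {0..x}) + (y - x)"
    if "x \<le> y" for x y :: real
  proof -
    have "measure lebesgue (E \<inter> {0..y}) \<le> measure lebesgue ((E \<inter> {0..x}) \<union> {x..y})"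
      using fm by (intro measure_mono_fmeasurable fmeasurable.Un fmeasurableD) auto
    also have "\<dots> \<le> measure lebesgue (E \<inter> {0..x}) + measure lebesgue {x..y}"
      using fm by (intro measure_Un_le fmeasurableD) auto
    finally show ?thesis using that by simp
  qed
  have mono: "measure lebesgue (E \<inter> {0..x}) \<le> measure lebesgue (E \<inter> {0..y})" if "x \<le> y" for x y :: real
    using fm that by (intro measure_mono_fmeasurable fmeasurableD) auto
  show "1-lipschitz_on UNIV (\<lambda>y. measure lebesgue (E \<inter> {0..y}))"
  proof (rule lipschitz_onI)
    fix x y :: real
    show "dist (measure lebesgue (E \<inter> {0..x})) (measure lebesgue (E \<inter> {0..y})) \<le> 1 * dist x y"
      using *[of x y] *[of y x] mono[of x y] mono[of y x] by (cases "x \<le> y") (auto simp: dist_real_def)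
  qed simp
qed

text \<open>This is the monotone transport: mass of F to the left of x is matched with mass of E to
  the left of \<theta> x. Injectivity is not sought, so gaps in E or F and null sets do no
  harm.\<close>

lemma transport_exists:
  fixes E F :: "real set"
  assumes E: "E \<subseteq> {0<..<1}" "E \<in> sets lebesgue"
    and F: "F \<subseteq> {0<..<1}" "F \<in> sets lebesgue"
    and eq: "measure lebesgue E = measure lebesgue F"
  obtains \<theta> :: "real \<Rightarrow> real" where "\<And>x. \<theta> x \<in> {0<..<1}"
    "\<And>A. A \<in> sets lebesgue \<Longrightarrow> {x \<in> F. \<theta> x \<in> A} \<in> sets lebesgue"
    "\<And>A. A \<in> sets lebesgue \<Longrightarrow> emeasure lebesgue {x \<in> F. \<theta> x \<in> A} = emeasure lebesgue (A \<inter> E)"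
proof -
  define e where "e = (\<lambda>y. measure lebesgue (E \<inter> {0..y}))"
  define f where "f = (\<lambda>y. measure lebesgue (F \<inter> {0..y}))"
  define m where "m = measure lebesgue E"
  \<comment> \<open>The generalised inverse of the cumulative function of E, applied to that of
    F.\<close>
  define \<theta> where "\<theta> = (\<lambda>x. Inf {y\<in>{0..1}. f x \<le> e y})"
  have fmE: "E \<inter> A \<in> fmeasurable lebesgue" if "A \<in> sets lebesgue" for A
    by (rule fmeasurableI2[of "{0..1}"]) (use that E in auto)
  have fmF: "F \<inter> A \<in> fmeasurable lebesgue" if "A \<in> sets lebesgue" for A
    by (rule fmeasurableI2[of "{0..1}"]) (use that F in auto)
  have ce: "continuous_on UNIV e" and cf: "continuous_on UNIV f"
    unfolding e_def f_def using E F by (simp_all add: cumulative_continuous)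
  have me: "e x \<le> e y" if "x \<le> y" for x y
    unfolding e_def using that by (intro measure_mono_fmeasurable fmE fmeasurableD) auto
  have mf: "f x \<le> f y" if "x \<le> y" for x y
    unfolding f_def using that by (intro measure_mono_fmeasurable fmF fmeasurableD) auto
  have e1: "e 1 = m" unfolding e_def m_def using E by (intro arg_cong[where f="measure lebesgue"]) auto
  have f1: "f 1 = m" unfolding f_def m_def eq using F by (intro arg_cong[where f="measure lebesgue"]) auto
  have "E \<inter> {0..0} = {}" "F \<inter> {0..0} = {}" using E F by auto
  then have e0: "e 0 = 0" and f0: "f 0 = 0" by (simp_all only: e_def f_def measure_empty)
  have f_le: "f x \<le> m" for x
    unfolding f_def m_def eq using fmF[of UNIV] by (intro measure_mono_fmeasurable fmF fmeasurableD) auto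
  \<comment> \<open>Continuity of e makes the infimum a minimum. The resulting Galois connection
    turns sublevel sets of \<theta> into sublevel sets of f.\<close>
  have \<theta>_le_iff: "\<theta> x \<le> y \<longleftrightarrow> f x \<le> e y" if "y \<in> {0..1}" for x y
  proof -
    let ?S = "{y\<in>{0..1}. f x \<le> e y}"
    have ne: "?S \<noteq> {}" using f_le[of x] e1 by (auto intro!: exI[of _ 1])
    have "closed ?S"
      by (auto simp: Collect_conj_eq intro!: closed_Int closed_Collect_le continuous_on_subset[OF ce])
    then have "\<theta> x \<in> ?S" unfolding \<theta>_def using ne by (intro closed_contains_Inf) auto
    moreover have "\<theta> x \<le> y" if "y \<in> ?S" for y
      unfolding \<theta>_def using that by (intro cInf_lower) auto
    ultimately show ?thesis using that me[of "\<theta> x" y] by auto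
  qed
  have \<theta>_range: "\<theta> x \<in> {0..1}" for x
  proof -
    have "\<theta> x \<le> 1" using \<theta>_le_iff[of 1 x] f_le[of x] e1 by auto
    moreover have "0 \<le> \<theta> x" unfolding \<theta>_def using f_le[of x] e1 by (intro cInf_greatest) auto
    ultimately show ?thesis by auto
  qed
  \<comment> \<open>Inside F, a sublevel set of f is an initial interval. At its last point f takes
    the value c exactly, because f is continuous and cannot jump over c.\<close>
  have level: "\<exists>z. F \<inter> {x. f x \<le> c} = F \<inter> {0..z} \<and> f z = c" if c: "c \<in> {0..m}" for c
  proof -
    let ?S = "{x\<in>{0..1}. f x \<le> c}"
    have "closed ?S"
      by (auto simp: Collect_conj_eq intro!: closed_Int closed_Collect_le continuous_on_subset[OF cf])
    moreover have "?S \<noteq> {}" using f0 c by (auto intro!: exI[of _ 0])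
    ultimately have z: "Sup ?S \<in> ?S" by (intro closed_contains_Sup) auto
    have up: "x \<le> Sup ?S" if "x \<in> ?S" for x using that by (intro cSup_upper) auto
    have "f (Sup ?S) = c"
    proof (rule ccontr)
      assume "f (Sup ?S) \<noteq> c"
      with z have lt: "f (Sup ?S) < c" by auto
      obtain x where x: "Sup ?S \<le> x" "x \<le> 1" "f x = c"
        using IVT'[of f "Sup ?S" c 1] z lt c f1 continuous_on_subset[OF cf] by auto
      with up[of x] z lt show False by auto
    qed
    moreover have "F \<inter> {x. f x \<le> c} = F \<inter> {0..Sup ?S}"
    proof (intro set_eqI iffI)
      fix x assume "x \<in> F \<inter> {x. f x \<le> c}"
      with up[of x] F(1) show "x \<in> F \<inter> {0..Sup ?S}" by force
    next
      fix x assume "x \<in> F \<inter> {0..Sup ?S}"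
      with mf[of x "Sup ?S"] z show "x \<in> F \<inter> {x. f x \<le> c}" by auto
    qed
    ultimately show ?thesis by blast
  qed
  have "mono \<theta>"
  proof (rule monoI)
    fix x y :: real assume "x \<le> y"
    then show "\<theta> x \<le> \<theta> y"
      using \<theta>_le_iff[of "\<theta> y" x] \<theta>_le_iff[of "\<theta> y" y] \<theta>_range[of y] mf[of x y] by auto
  qed
  then have \<theta>_meas: "\<theta> \<in> borel_measurable borel" by (rule borel_measurable_mono)
  have \<theta>_sets: "{x. \<theta> x \<in> A} \<in> sets lebesgue" if "A \<in> sets borel" for A
    using measurable_sets[OF measurable_completion[of \<theta> lborel borel], of A] \<theta>_meas that
    by (auto simp: vimage_def)
  have \<theta>_meas': "\<theta> \<in> borel_measurable (lebesgue_on F)"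
    using \<theta>_meas by (intro measurable_restrict_space1 measurable_completion) auto
  have le: "measure lebesgue {x\<in>F. \<theta> x \<le> y} = measure lebesgue {x\<in>E. x \<le> y}" if y: "y \<in> {0..1}" for y
  proof -
    have "e y \<in> {0..m}" using e0 e1 me[of 0 y] me[of y 1] y by auto
    from level[OF this] obtain z where z: "F \<inter> {x. f x \<le> e y} = F \<inter> {0..z}" "f z = e y" by blast
    have "{x\<in>F. \<theta> x \<le> y} = F \<inter> {0..z}" using z \<theta>_le_iff[OF y] by auto
    moreover have "{x\<in>E. x \<le> y} = E \<inter> {0..y}" using E by auto
    ultimately show ?thesis using z(2) by (simp add: e_def f_def)
  qed
  have gr: "measure lebesgue {x\<in>F. y < \<theta> x} = measure lebesgue {x\<in>E. y < x}" for y
  proof -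
    consider "y < 0" | "y \<in> {0..1}" | "1 < y" by force
    then show ?thesis
    proof cases
      case 1
      then have "{x\<in>F. y < \<theta> x} = F" "{x\<in>E. y < x} = E"
        using \<theta>_range E(1) by (auto simp: less_le_trans)
      then show ?thesis by (simp add: eq)
    next
      case 3
      then have "{x\<in>F. y < \<theta> x} = {}" "{x\<in>E. y < x} = {}"
        using \<theta>_range E(1) by (auto simp: not_less intro: order_trans[OF _ less_imp_le])
      then show ?thesis by (simp only: measure_empty)
    next
      case 2
      have [measurable]: "{x\<in>F. \<theta> x \<le> y} \<in> sets lebesgue"
      proof -
        have "{x. \<theta> x \<le> y} \<in> sets lebesgue"
          using \<theta>_sets[of "{..y}"] by simp
        then show ?thesis using F(2) by (simp add: Collect_conj_eq sets.Int)
      qed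
      have "measure lebesgue {x\<in>F. y < \<theta> x} = measure lebesgue (F - {x\<in>F. \<theta> x \<le> y})"
        by (rule arg_cong[where f="measure lebesgue"]) auto
      also have "\<dots> = measure lebesgue F - measure lebesgue {x\<in>F. \<theta> x \<le> y}"
        using fmF[of UNIV] by (intro measurable_measure_Diff) auto
      also have "\<dots> = measure lebesgue E - measure lebesgue {x\<in>E. x \<le> y}"
        using le[OF 2] eq by simp
      also have "\<dots> = measure lebesgue (E - {x\<in>E. x \<le> y})"
        using fmE[of UNIV] E(2) by (intro measurable_measure_Diff[symmetric]) (auto simp: Collect_conj_eq)
      also have "\<dots> = measure lebesgue {x\<in>E. y < x}"
        by (rule arg_cong[where f="measure lebesgue"]) auto
      finally show ?thesis .
    qed
  qed
  have *: "distr (lebesgue_on F) borel \<theta> = distr (lebesgue_on E) borel (\<lambda>x. x)"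
  proof (rule measure_eqI_lessThan)
    fix y
    have id: "(\<lambda>x. x) \<in> borel_measurable (lebesgue_on E)"
      by (intro measurable_restrict_space1 measurable_completion) auto
    have 1: "emeasure (distr (lebesgue_on F) borel \<theta>) {y<..} = emeasure lebesgue {x\<in>F. y < \<theta> x}"
      using \<theta>_meas' F(2) by (subst emeasure_distr)
        (auto simp: emeasure_restrict_space space_restrict_space intro!: arg_cong[where f="emeasure lebesgue"])
    have 2: "emeasure (distr (lebesgue_on E) borel (\<lambda>x. x)) {y<..} = emeasure lebesgue {x\<in>E. y < x}"
      using id E(2) by (subst emeasure_distr)
        (auto simp: emeasure_restrict_space space_restrict_space intro!: arg_cong[where f="emeasure lebesgue"])
    have "{x\<in>F. y < \<theta> x} \<in> fmeasurable lebesgue"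
    proof -
      have "{x. y < \<theta> x} \<in> sets lebesgue"
          using \<theta>_sets[of "{y<..}"] by simp
      from fmF[OF this] show ?thesis by (simp add: Collect_conj_eq)
    qed
    moreover have "{x\<in>E. y < x} \<in> fmeasurable lebesgue"
      using fmE[of "{y<..}"] by (simp add: Collect_conj_eq greaterThan_def)
    ultimately show "emeasure (distr (lebesgue_on F) borel \<theta>) {y<..} = emeasure (distr (lebesgue_on E) borel (\<lambda>x. x)) {y<..}"
      "emeasure (distr (lebesgue_on F) borel \<theta>) {y<..} < \<infinity>"
      unfolding 1 2 using gr[of y] by (simp_all add: emeasure_eq_measure2)
  qed auto
  have B: "{x\<in>F. \<theta> x \<in> A} \<in> sets lebesgue \<and> emeasure lebesgue {x\<in>F. \<theta> x \<in> A} = emeasure lebesgue (A \<inter> E)"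
    if "A \<in> sets borel" for A
  proof -
    have id: "(\<lambda>x. x) \<in> borel_measurable (lebesgue_on E)"
      by (intro measurable_restrict_space1 measurable_completion) auto
    have "emeasure (distr (lebesgue_on F) borel \<theta>) A = emeasure lebesgue {x\<in>F. \<theta> x \<in> A}"
      using \<theta>_meas' F(2) that by (subst emeasure_distr)
        (auto simp: emeasure_restrict_space space_restrict_space intro!: arg_cong[where f="emeasure lebesgue"])
    moreover have "emeasure (distr (lebesgue_on E) borel (\<lambda>x. x)) A = emeasure lebesgue (A \<inter> E)"
      using id E(2) that by (subst emeasure_distr)
        (auto simp: emeasure_restrict_space space_restrict_space intro!: arg_cong[where f="emeasure lebesgue"])
    moreover have "{x. \<theta> x \<in> A} \<in> sets lebesgue"
      using that by (rule \<theta>_sets)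
    ultimately show ?thesis using F(2) * by (simp add: Collect_conj_eq sets.Int)
  qed
  \<comment> \<open>Preimages of Lebesgue sets under a Borel map can fail to be Lebesgue sets. Here
    the Borel case already shows that the preimage of the Borel null set \<open>N'\<close> is null,
    so subsets of \<open>N'\<close> cause no trouble.\<close>
  have L: "{x\<in>F. \<theta> x \<in> A} \<in> sets lebesgue \<and> emeasure lebesgue {x\<in>F. \<theta> x \<in> A} = emeasure lebesgue (A \<inter> E)"
    if A: "A \<in> sets lebesgue" for A
  proof -
    obtain S N N' where S: "A = S \<union> N" "N \<subseteq> N'" "N' \<in> null_sets lborel" "S \<in> sets lborel"
      using sets_completionE[OF A] by metis
    have N': "N' \<in> null_sets lebesgue" using S(3) by (rule null_sets_completionI)
    have "emeasure lebesgue {x\<in>F. \<theta> x \<in> N'} = emeasure lebesgue (N' \<inter> E)" "{x\<in>F. \<theta> x \<in> N'} \<in> sets lebesgue"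
      using B[of N'] S(3) by auto
    moreover have "emeasure lebesgue (N' \<inter> E) = 0"
      using null_set_Int2[OF N' E(2)] by (auto simp: Int_commute)
    ultimately have nF: "{x\<in>F. \<theta> x \<in> N'} \<in> null_sets lebesgue" by auto
    have nF': "{x\<in>F. \<theta> x \<in> N} \<in> null_sets lebesgue"
      by (rule null_sets_completion_subset[OF _ nF]) (use S(2) in auto)
    have nE: "N \<inter> E \<in> null_sets lebesgue"
      by (rule null_sets_completion_subset[OF _ N']) (use S(2) in auto)
    have eF: "{x\<in>F. \<theta> x \<in> A} = {x\<in>F. \<theta> x \<in> S} \<union> {x\<in>F. \<theta> x \<in> N}" using S(1) by auto
    have eE: "A \<inter> E = (S \<inter> E) \<union> (N \<inter> E)" using S(1) by auto
    have SB: "{x\<in>F. \<theta> x \<in> S} \<in> sets lebesgue" "emeasure lebesgue {x\<in>F. \<theta> x \<in> S} = emeasure lebesgue (S \<inter> E)"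
      using B[of S] S(4) by auto
    have "S \<inter> E \<in> sets lebesgue" using S(4) E(2) by auto
    then show ?thesis
      unfolding eF eE using SB nF' nE by (auto simp: emeasure_Un_null_set)
  qed
  \<comment> \<open>The values of \<theta> lie in [0,1] and may be an endpoint, but only on a null
    subset of F. Any interior value repairs this; 1/2 is arbitrary.\<close>
  define \<theta>' where "\<theta>' x = (if \<theta> x \<in> {0<..<1} then \<theta> x else 1/2)" for x
  have L': "{x\<in>F. \<theta>' x \<in> A} \<in> sets lebesgue \<and> emeasure lebesgue {x\<in>F. \<theta>' x \<in> A} = emeasure lebesgue (A \<inter> E)"
    if A: "A \<in> sets lebesgue" for A
  proof -
    let ?Z = "{x\<in>F. \<theta> x \<in> - {0<..<1}}"
    have Z: "?Z \<in> null_sets lebesgue"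
    proof (rule null_setsI)
      have "- {0<..<1} \<inter> E = {}" using E(1) by auto
      then show "emeasure lebesgue ?Z = 0" using L[of "- {0<..<1}"] by (simp only:) auto
    qed (use L[of "- {0<..<1}"] in auto)
    let ?P = "{x\<in>F. \<theta> x \<in> A \<inter> {0<..<1}}"
    have AA: "A \<inter> {0<..<1} \<in> sets lebesgue" using A by auto
    have eq2: "A \<inter> {0<..<1} \<inter> E = A \<inter> E" using E(1) by auto
    have P: "?P \<in> sets lebesgue" "emeasure lebesgue ?P = emeasure lebesgue (A \<inter> E)"
      using L[OF AA] unfolding eq2 by auto
    have "{x\<in>F. \<theta>' x \<in> A} = ?P \<union> (if 1/2 \<in> A then ?Z else {})"
      unfolding \<theta>'_def by auto
    moreover have "(if 1/2 \<in> A then ?Z else {}) \<in> null_sets lebesgue" using Z by auto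
    ultimately show ?thesis using P by (auto simp: emeasure_Un_null_set)
  qed
  have "\<theta>' x \<in> {0<..<1}" for x by (auto simp: \<theta>'_def)
  then show thesis using that[of \<theta>'] L' by blast
qed

section \<open>Lebesgue measure on (0,1) and its measure-preserving maps\<close>

lemma sets_leb01_iff: "A \<in> sets leb01 \<longleftrightarrow> A \<subseteq> {0<..<1} \<and> A \<in> sets lebesgue"
  by (subst sets_restrict_space_iff) auto

lemma emeasure_leb01: "A \<subseteq> {0<..<1} \<Longrightarrow> emeasure leb01 A = emeasure lebesgue A"
  by (rule emeasure_restrict_space) auto

lemma measure_leb01: "A \<subseteq> {0<..<1} \<Longrightarrow> measure leb01 A = measure lebesgue A"
  by (rule measure_restrict_space) auto

lemma space_leb01: "space leb01 = {0<..<1}"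
  by (simp add: space_restrict_space)

lemma emeasure_space_leb01: "emeasure leb01 {0<..<1} = 1"
  by (simp add: emeasure_leb01)

lemma finite_measure_leb01: "finite_measure leb01"
  by (intro finite_measureI) (simp add: emeasure_space_leb01 space_leb01)

lemma AE_leb01_iff: "(AE x in leb01. P x) \<longleftrightarrow> (AE x in lebesgue. 0 < x \<and> x < 1 \<longrightarrow> P x)"
  by (subst AE_restrict_space_iff) auto

definition mpres :: "(real \<Rightarrow> real) set" where
  "mpres = {\<theta> \<in> measurable leb01 leb01. distr leb01 leb01 \<theta> = leb01}"

lemma mpres_measurable: "\<theta> \<in> mpres \<Longrightarrow> \<theta> \<in> measurable leb01 leb01"
  by (simp add: mpres_def)

lemma mpres_emeasure:
  assumes "\<theta> \<in> mpres" "A \<in> sets leb01"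
  shows "emeasure leb01 {x \<in> {0<..<1}. \<theta> x \<in> A} = emeasure leb01 A"
proof -
  have "emeasure leb01 A = emeasure (distr leb01 leb01 \<theta>) A"
    using assms by (simp add: mpres_def)
  also have "\<dots> = emeasure leb01 (\<theta> -` A \<inter> space leb01)"
    using assms by (intro emeasure_distr) (auto simp: mpres_def)
  also have "\<theta> -` A \<inter> space leb01 = {x \<in> {0<..<1}. \<theta> x \<in> A}"
    by (auto simp: space_leb01)
  finally show ?thesis ..
qed

lemma mpresI:
  assumes "\<And>x. x \<in> {0<..<1} \<Longrightarrow> \<theta> x \<in> {0<..<1}"
    and "\<And>A. A \<in> sets leb01 \<Longrightarrow> {x \<in> {0<..<1}. \<theta> x \<in> A} \<in> sets leb01"
    and "\<And>A. A \<in> sets leb01 \<Longrightarrow> emeasure leb01 {x \<in> {0<..<1}. \<theta> x \<in> A} = emeasure leb01 A"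
  shows "\<theta> \<in> mpres"
proof -
  have eq: "\<theta> -` A \<inter> space leb01 = {x \<in> {0<..<1}. \<theta> x \<in> A}" for A
    by (auto simp: space_leb01)
  have m: "\<theta> \<in> measurable leb01 leb01"
    by (rule measurableI, unfold eq) (use assms in \<open>simp_all add: space_leb01\<close>)
  have "distr leb01 leb01 \<theta> = leb01"
  proof (rule measure_eqI)
    fix A assume "A \<in> sets (distr leb01 leb01 \<theta>)"
    then have A: "A \<in> sets leb01" by simp
    have "emeasure (distr leb01 leb01 \<theta>) A = emeasure leb01 (\<theta> -` A \<inter> space leb01)"
      using m A by (rule emeasure_distr)
    with assms(3)[OF A] show "emeasure (distr leb01 leb01 \<theta>) A = emeasure leb01 A"
      by (simp only: eq)
  qed simp
  with m show ?thesis by (simp add: mpres_def)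
qed

lemma AE_mpres:
  assumes "\<theta> \<in> mpres" "AE x in leb01. P x"
  shows "AE x in leb01. P (\<theta> x)"
proof -
  have "distr leb01 leb01 \<theta> = leb01" using assms(1) by (simp add: mpres_def)
  then have "AE x in distr leb01 leb01 \<theta>. P x" using assms(2) by (simp only:)
  with mpres_measurable[OF assms(1)] show ?thesis by (rule AE_distrD)
qed

lemma mpres_id: "(\<lambda>x. x) \<in> mpres"
  by (simp add: mpres_def)

text \<open>For P5: the reflection moves the left half of (0,1) to the right half, which is where
  the tail integral at 1/2 can see it.\<close>

lemma mpres_reflection: "(\<lambda>x. 1 - x) \<in> mpres"
proof (rule mpresI)
  have l: "lebesgue = distr lebesgue lebesgue (\<lambda>x::real. 1 - x)"
    using lebesgue_real_affine[of "-1" 1] by (simp add: density_1)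
  have m: "(\<lambda>x::real. 1 - x) \<in> lebesgue \<rightarrow>\<^sub>M lebesgue"
    using lebesgue_affine_measurable[of "\<lambda>_::real. -1" 1] by simp
  fix A assume "A \<in> sets leb01"
  then have A: "A \<subseteq> {0<..<1}" "A \<in> sets lebesgue" by (simp_all add: sets_leb01_iff)
  have eq: "{x \<in> {0<..<1}. 1 - x \<in> A} = (\<lambda>x. 1 - x) -` A \<inter> space lebesgue"
    using A(1) by auto
  show "{x \<in> {0<..<1}. 1 - x \<in> A} \<in> sets leb01"
    using measurable_sets[OF m A(2)] unfolding sets_leb01_iff eq[symmetric] by auto
  have "emeasure lebesgue A = emeasure (distr lebesgue lebesgue (\<lambda>x::real. 1 - x)) A"
    by (subst l) (rule refl)
  also have "\<dots> = emeasure lebesgue {x \<in> {0<..<1}. 1 - x \<in> A}"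
    unfolding eq using m A(2) by (rule emeasure_distr)
  finally have "emeasure lebesgue A = emeasure lebesgue {x \<in> {0<..<1}. 1 - x \<in> A}" .
  moreover have "{x \<in> {0<..<1}. 1 - x \<in> A} \<subseteq> {0<..<1}" by auto
  ultimately show "emeasure leb01 {x \<in> {0<..<1}. 1 - x \<in> A} = emeasure leb01 A"
    using A(1) by (simp only: emeasure_leb01)
qed auto

text \<open>Each cell \<open>{q = c}\<close> is sent to the cell \<open>{p = c}\<close> of the same
  measure, and the countably many transports are glued. The conclusion holds only almost everywhere,
  since a transport may leave its target cell on a null set.\<close>

lemma mpres_lift:
  fixes p q :: "real \<Rightarrow> 'c::countable"
  assumes p: "p \<in> measurable leb01 (count_space UNIV)" and q: "q \<in> measurable leb01 (count_space UNIV)"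
    and eq: "\<And>c. measure leb01 {x \<in> {0<..<1}. p x = c} = measure leb01 {x \<in> {0<..<1}. q x = c}"
  obtains \<theta> where "\<theta> \<in> mpres" "AE x in leb01. p (\<theta> x) = q x"
proof -
  define E where "E c = {x \<in> {0<..<1}. p x = c}" for c
  define F where "F c = {x \<in> {0<..<1}. q x = c}" for c
  have sub: "E c \<subseteq> {0<..<1}" "F c \<subseteq> {0<..<1}" for c by (auto simp: E_def F_def)
  have E01: "E c \<in> sets leb01" for c
    using measurable_sets[OF p, of "{c}"] by (simp add: E_def vimage_def space_leb01 Int_def conj_commute)
  have F01: "F c \<in> sets leb01" for c
    using measurable_sets[OF q, of "{c}"] by (simp add: F_def vimage_def space_leb01 Int_def conj_commute)
  have Es: "E c \<in> sets lebesgue" and Fs: "F c \<in> sets lebesgue" for c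
    using E01 F01 by (simp_all add: sets_leb01_iff)
  have meq: "measure lebesgue (E c) = measure lebesgue (F c)" for c
    using eq[of c] sub[of c] by (simp only: measure_leb01 flip: E_def F_def)
  let ?P = "\<lambda>c \<theta>. (\<forall>x. \<theta> x \<in> {0<..<1}) \<and> (\<forall>A\<in>sets lebesgue. {x \<in> F c. \<theta> x \<in> A} \<in> sets lebesgue \<and>
      emeasure lebesgue {x \<in> F c. \<theta> x \<in> A} = emeasure lebesgue (A \<inter> E c))"
  have "\<exists>\<theta>. ?P c \<theta>" if "measure lebesgue (E c) = measure lebesgue (F c)" for c
    using that
    by (rule transport_exists[OF sub(1)[of c] Es[of c] sub(2)[of c] Fs[of c]]) blast
  then have "\<exists>\<Theta>. \<forall>c. ?P c (\<Theta> c)" using meq by (intro choice) blast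
  then obtain \<Theta> where \<Theta>: "\<And>c x. \<Theta> c x \<in> {0<..<1}"
    "\<And>c A. A \<in> sets lebesgue \<Longrightarrow> {x \<in> F c. \<Theta> c x \<in> A} \<in> sets lebesgue"
    "\<And>c A. A \<in> sets lebesgue \<Longrightarrow> emeasure lebesgue {x \<in> F c. \<Theta> c x \<in> A} = emeasure lebesgue (A \<inter> E c)"
    by blast
  define \<theta> where "\<theta> x = \<Theta> (q x) x" for x
  have "\<theta> \<in> mpres"
  proof (rule mpresI)
    fix A assume "A \<in> sets leb01"
    then have A: "A \<subseteq> {0<..<1}" "A \<in> sets lebesgue" by (simp_all add: sets_leb01_iff)
    have 1: "{x \<in> {0<..<1}. \<theta> x \<in> A} = (\<Union>c. {x \<in> F c. \<Theta> c x \<in> A})"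
      by (auto simp: \<theta>_def F_def)
    have 2: "A = (\<Union>c. A \<inter> E c)" using A(1) by (auto simp: E_def)
    have s: "(\<Union>c. {x \<in> F c. \<Theta> c x \<in> A}) \<in> sets lebesgue"
      using \<Theta>(2)[OF A(2)] by (intro sets.countable_UN'') auto
    then show "{x \<in> {0<..<1}. \<theta> x \<in> A} \<in> sets leb01"
      unfolding sets_leb01_iff 1[symmetric] by auto
    have "emeasure lebesgue {x \<in> {0<..<1}. \<theta> x \<in> A} = (\<integral>\<^sup>+ c. emeasure lebesgue {x \<in> F c. \<Theta> c x \<in> A} \<partial>count_space UNIV)"
      unfolding 1 using \<Theta>(2)[OF A(2)]
      by (intro emeasure_UN_countable) (auto simp: disjoint_family_on_def F_def)
    also have "\<dots> = (\<integral>\<^sup>+ c. emeasure lebesgue (A \<inter> E c) \<partial>count_space UNIV)"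
      using \<Theta>(3)[OF A(2)] by simp
    also have "\<dots> = emeasure lebesgue (\<Union>c. A \<inter> E c)"
      using A(2) Es by (intro emeasure_UN_countable[symmetric]) (auto simp: disjoint_family_on_def E_def)
    finally have "emeasure lebesgue {x \<in> {0<..<1}. \<theta> x \<in> A} = emeasure lebesgue A"
      using 2 by simp
    moreover have "{x \<in> {0<..<1}. \<theta> x \<in> A} \<subseteq> {0<..<1}" by auto
    ultimately show "emeasure leb01 {x \<in> {0<..<1}. \<theta> x \<in> A} = emeasure leb01 A"
      using A(1) by (simp only: emeasure_leb01)
  qed (use \<Theta>(1) in \<open>simp add: \<theta>_def\<close>)
  \<comment> \<open>The bad points of \<open>F c\<close> form the preimage of \<open>- E c\<close>,
    whose measure is that of \<open>- E c \<inter> E c\<close>.\<close>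
  moreover have "AE x in leb01. \<forall>c. q x = c \<longrightarrow> p (\<Theta> c x) = c"
  proof (subst AE_all_countable, intro allI)
    fix c
    let ?N = "{x \<in> F c. \<Theta> c x \<in> - E c}"
    have cE: "- E c \<in> sets lebesgue" using sets.compl_sets[OF Es[of c]] by (simp add: Compl_eq_Diff_UNIV)
    have "emeasure lebesgue ?N = 0"
      using \<Theta>(3)[OF cE, of c] by simp
    moreover have "?N \<in> sets lebesgue" using \<Theta>(2)[OF cE] .
    moreover have "?N \<subseteq> {0<..<1}" using sub by auto
    ultimately have "?N \<in> null_sets leb01"
      by (auto simp: null_sets_def sets_leb01_iff emeasure_leb01)
    then show "AE x in leb01. q x = c \<longrightarrow> p (\<Theta> c x) = c"
      by (rule AE_I') (use \<Theta>(1) in \<open>auto simp: space_leb01 F_def E_def\<close>)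
  qed
  then have "AE x in leb01. p (\<theta> x) = q x"
    by eventually_elim (auto simp: \<theta>_def)
  ultimately show thesis by (rule that)
qed

section \<open>Distribution functions, rearrangements and equimeasurability\<close>

definition level_measure :: "(real \<Rightarrow> ereal) \<Rightarrow> real \<Rightarrow> real" where
  "level_measure f s = measure leb01 {x \<in> {0<..<1}. ereal s < \<bar>f x\<bar>}"

lemma rearr_eq_level: "rearr f t = (INF s \<in> {s::real. 0 < s \<and> level_measure f s \<le> t}. ereal s)"
  by (simp add: rearr_def level_measure_def)

lemma same_rearrI: "(\<And>s. 0 < s \<Longrightarrow> level_measure f s = level_measure g s) \<Longrightarrow> same_rearr f g"
  unfolding same_rearr_def rearr_eq_level by (auto intro!: INF_cong)

lemma level_measure_bounds: "0 \<le> level_measure f s" "level_measure f s \<le> 1"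
proof -
  interpret finite_measure leb01 by (rule finite_measure_leb01)
  show "0 \<le> level_measure f s" by (simp add: level_measure_def)
  have "level_measure f s \<le> measure leb01 (space leb01)"
    unfolding level_measure_def by (rule bounded_measure)
  then show "level_measure f s \<le> 1"
    by (simp add: measure_def space_leb01 emeasure_space_leb01)
qed

lemma level_sets:
  assumes "f \<in> M01"
  shows "{x \<in> {0<..<1}. c < \<bar>f x\<bar>} \<in> sets leb01"
proof -
  have [measurable]: "f \<in> borel_measurable leb01" using assms by (simp add: M01_def)
  have "{x \<in> space leb01. c < \<bar>f x\<bar>} \<in> sets leb01" by measurable
  then show ?thesis by (simp add: space_leb01)
qed

lemma level_measure_antimono:
  assumes "f \<in> M01" "s \<le> r"
  shows "level_measure f r \<le> level_measure f s"
proof -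
  interpret finite_measure leb01 by (rule finite_measure_leb01)
  have "ereal s < y" if "ereal r < y" for y using that assms(2) by (meson ereal_less_eq(3) le_less_trans)
  then show ?thesis
    unfolding level_measure_def using assms by (intro finite_measure_mono level_sets) auto
qed

text \<open>Because the level sets use a strict inequality, they increase to the set at level s as
  the level decreases to s. This right continuity makes the infimum defining f* well
  behaved.\<close>

lemma level_measure_right_limit:
  assumes "f \<in> M01"
  shows "(\<lambda>n. level_measure f (s + 1 / Suc n)) \<longlonglongrightarrow> level_measure f s"
proof -
  interpret finite_measure leb01 by (rule finite_measure_leb01)
  let ?A = "\<lambda>n. {x \<in> {0<..<1}. ereal (s + 1 / Suc n) < \<bar>f x\<bar>}"
  have "(\<lambda>n. measure leb01 (?A n)) \<longlonglongrightarrow> measure leb01 (\<Union>n. ?A n)"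
  proof (rule finite_Lim_measure_incseq)
    show "range ?A \<subseteq> sets leb01" using level_sets[OF assms] by auto
    have "1 / real (Suc n) \<le> 1 / real (Suc m)" if "m \<le> n" for m n
      using that by (intro divide_left_mono) auto
    then have "ereal (s + 1 / real (Suc n)) \<le> ereal (s + 1 / real (Suc m))" if "m \<le> n" for m n
      using that by simp
    then show "incseq ?A" unfolding incseq_def by (blast intro: le_less_trans)
  qed
  moreover have "(\<Union>n. ?A n) = {x \<in> {0<..<1}. ereal s < \<bar>f x\<bar>}"
  proof (intro set_eqI iffI)
    fix x assume "x \<in> (\<Union>n. ?A n)"
    then obtain n where "x \<in> {0<..<1}" "ereal (s + 1 / Suc n) < \<bar>f x\<bar>" by auto
    moreover have "ereal s \<le> ereal (s + 1 / Suc n)" by simp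
    ultimately show "x \<in> {x \<in> {0<..<1}. ereal s < \<bar>f x\<bar>}" by (blast intro: le_less_trans)
  next
    fix x assume x: "x \<in> {x \<in> {0<..<1}. ereal s < \<bar>f x\<bar>}"
    then obtain r where r: "ereal s < ereal r" "ereal r < \<bar>f x\<bar>" using ereal_dense2 by blast
    obtain n where "1 / real (Suc n) < r - s" using reals_Archimedean[of "r - s"] r(1) by (auto simp: inverse_eq_divide)
    then have "ereal (s + 1 / Suc n) < ereal r" by simp
    with r x show "x \<in> (\<Union>n. ?A n)" by (blast intro: less_trans)
  qed
  ultimately show ?thesis by (simp add: level_measure_def)
qed

text \<open>The rearrangement is the generalised inverse of the distribution function. All later
  facts on f* are obtained from this equivalence instead of the infimum.\<close>

lemma rearr_le_iff:
  assumes f: "f \<in> M01" and s: "0 < s"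
  shows "rearr f t \<le> ereal s \<longleftrightarrow> level_measure f s \<le> t"
proof
  assume "level_measure f s \<le> t"
  then show "rearr f t \<le> ereal s" unfolding rearr_eq_level using s by (intro INF_lower) auto
next
  assume le: "rearr f t \<le> ereal s"
  have *: "level_measure f r \<le> t" if "s < r" for r
  proof -
    have "rearr f t < ereal r" using le that by (simp add: le_less_trans)
    then obtain r' where "0 < r'" "level_measure f r' \<le> t" "ereal r' < ereal r"
      unfolding rearr_eq_level INF_less_iff by auto
    with level_measure_antimono[OF f, of r' r] show ?thesis by simp
  qed
  show "level_measure f s \<le> t"
    by (rule LIMSEQ_le_const2[OF level_measure_right_limit[OF f]]) (use * in auto)
qed

lemma same_rearr_level:
  assumes "f \<in> M01" "g \<in> M01" "same_rearr f g" "0 < s"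
  shows "level_measure f s = level_measure g s"
proof -
  have "level_measure f s \<le> level_measure g s"
    if "f \<in> M01" "g \<in> M01" "same_rearr f g" for f g
  proof -
    \<comment> \<open>Choosing t to be the measure of the level set of g makes the equivalence above
      trivial for g; it lies in [0,1], where f* and g* are known to agree.\<close>
    have "rearr g (level_measure g s) \<le> ereal s"
      using that assms(4) by (simp add: rearr_le_iff)
    then have "rearr f (level_measure g s) \<le> ereal s"
      using that level_measure_bounds[of g s] by (simp add: same_rearr_def)
    then show ?thesis using that assms(4) by (simp add: rearr_le_iff)
  qed
  from this[of f g] this[of g f] assms show ?thesis by (force simp: same_rearr_def)
qed

text \<open>Within (0,1) the set where f* exceeds s is the interval from 0 to
  \<open>level_measure f s\<close>.\<close>

lemma same_rearr_rearr:
  assumes "f \<in> M01"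
  shows "same_rearr (rearr f) f"
proof (rule same_rearrI)
  fix s :: real assume s: "0 < s"
  have nn: "0 \<le> rearr f x" for x unfolding rearr_eq_level by (intro INF_greatest) auto
  have "{x \<in> {0<..<1}. ereal s < \<bar>rearr f x\<bar>} = {x \<in> {0<..<1}. \<not> rearr f x \<le> ereal s}"
    using nn by (auto simp: not_le)
  also have "\<dots> = {0<..<level_measure f s}"
    using level_measure_bounds[of f s] by (auto simp: rearr_le_iff[OF assms s])
  finally have "level_measure (rearr f) s = measure leb01 {0<..<level_measure f s}"
    by (simp add: level_measure_def)
  also have "\<dots> = measure lebesgue {0<..<level_measure f s}"
    using level_measure_bounds[of f s] by (intro measure_leb01) auto
  finally show "level_measure (rearr f) s = level_measure f s"
    using level_measure_bounds[of f s] by simp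
qed

lemma same_rearr_comp_mpres:
  assumes f: "f \<in> M01" and \<theta>: "\<theta> \<in> mpres"
  shows "same_rearr (\<lambda>x. f (\<theta> x)) f"
proof (rule same_rearrI)
  fix s :: real
  let ?A = "{x \<in> {0<..<1}. ereal s < \<bar>f x\<bar>}"
  have "\<theta> x \<in> {0<..<1}" if "x \<in> {0<..<1}" for x
    using measurable_space[OF mpres_measurable[OF \<theta>], of x] that by (simp add: space_leb01)
  then have "{x \<in> {0<..<1}. ereal s < \<bar>f (\<theta> x)\<bar>} = {x \<in> {0<..<1}. \<theta> x \<in> ?A}" by auto
  then show "level_measure (\<lambda>x. f (\<theta> x)) s = level_measure f s"
    unfolding level_measure_def measure_def using mpres_emeasure[OF \<theta> level_sets[OF f]] by simp
qed

lemma M01_plus_comp_mpres: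
  assumes "f \<in> M01_plus" "\<theta> \<in> mpres"
  shows "(\<lambda>x. f (\<theta> x)) \<in> M01_plus"
  using assms AE_mpres[OF assms(2), of "\<lambda>x. 0 \<le> f x"]
  by (auto simp: M01_plus_def M01_def intro: measurable_compose[OF mpres_measurable])

lemma emeasure_leb01_eqI: "measure leb01 A = measure leb01 B \<Longrightarrow> emeasure leb01 A = emeasure leb01 B"
proof -
  interpret finite_measure leb01 by (rule finite_measure_leb01)
  show "measure leb01 A = measure leb01 B \<Longrightarrow> emeasure leb01 A = emeasure leb01 B"
    by (simp add: emeasure_eq_measure)
qed

text \<open>Rearrangements only record positive levels. For functions nonnegative a.e. this suffices
  to fix the law: level 0 follows by right continuity, and negative levels have full
  measure.\<close>

lemma same_rearr_distr:
  assumes f: "f \<in> M01_plus" and g: "g \<in> M01_plus" and fg: "same_rearr f g"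
  shows "distr leb01 borel f = distr leb01 borel g"
proof -
  interpret finite_measure leb01 by (rule finite_measure_leb01)
  have M: "f \<in> M01" "g \<in> M01" using f g by (auto simp: M01_plus_def)
  have [measurable]: "f \<in> borel_measurable leb01" "g \<in> borel_measurable leb01"
    using M by (auto simp: M01_def)
  have pos: "level_measure f s = level_measure g s" if "0 < s" for s
    using same_rearr_level[OF M fg that] .
  have zero: "level_measure f 0 = level_measure g 0"
  proof (rule LIMSEQ_unique)
    show "(\<lambda>n. level_measure g (0 + 1 / Suc n)) \<longlonglongrightarrow> level_measure f 0"
      using level_measure_right_limit[OF M(1), of 0] by (simp add: pos)
  qed (rule level_measure_right_limit[OF M(2)])
  have level: "measure leb01 {x \<in> space leb01. ereal s < u x} = (if s < 0 then 1 else level_measure u s)"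
    if u: "u \<in> M01_plus" for u s
  proof -
    have [measurable]: "u \<in> borel_measurable leb01" and nn: "AE x in leb01. 0 \<le> u x" using u by (auto simp: M01_plus_def M01_def)
    show ?thesis
    proof (cases "s < 0")
      case True
      from nn have "AE x in leb01. x \<in> {x \<in> space leb01. ereal s < u x} \<longleftrightarrow> x \<in> space leb01"
        by eventually_elim (use True in \<open>auto intro: less_le_trans[of _ 0]\<close>)
      then have "measure leb01 {x \<in> space leb01. ereal s < u x} = measure leb01 (space leb01)"
        by (rule measure_eq_AE) measurable
      with True show ?thesis by (simp add: measure_def space_leb01 emeasure_space_leb01)
    next
      case False
      have "measure leb01 {x \<in> space leb01. ereal s < u x} = measure leb01 {x \<in> space leb01. ereal s < \<bar>u x\<bar>}"
      proof (rule measure_eq_AE)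
        from nn show "AE x in leb01. x \<in> {x \<in> space leb01. ereal s < u x} \<longleftrightarrow> x \<in> {x \<in> space leb01. ereal s < \<bar>u x\<bar>}"
          by eventually_elim simp
      qed measurable
      with False show ?thesis by (simp add: level_measure_def space_leb01)
    qed
  qed
  have eq: "emeasure leb01 {x \<in> space leb01. y < f x} = emeasure leb01 {x \<in> space leb01. y < g x}" for y
  proof (cases y)
    case (real s)
    show ?thesis unfolding real
      using level[OF f, of s] level[OF g, of s] pos[of s] zero
      by (intro emeasure_leb01_eqI) (cases "s = 0"; auto)
  next
    case PInf then show ?thesis by simp
  next
    case MInf
    have "AE x in leb01. 0 \<le> f x" "AE x in leb01. 0 \<le> g x"
      using f g by (auto simp: M01_plus_def)
    then have "AE x in leb01. x \<in> {x \<in> space leb01. y < f x} \<longleftrightarrow> x \<in> {x \<in> space leb01. y < g x}"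
      by eventually_elim (use MInf in auto)
    then show ?thesis by (rule emeasure_eq_AE) measurable
  qed
  \<comment> \<open>Open rays never contain the point minus infinity, so they cannot exhaust the
    extended line. Adding \<open>UNIV\<close> gives a generator with a member of finite measure that
    does.\<close>
  let ?E = "insert UNIV (range greaterThan :: ereal set set)"
  have gen: "sets borel = sigma_sets UNIV ?E"
  proof -
    have "sets (borel :: ereal measure) = sigma_sets UNIV (range greaterThan)"
      by (subst borel_Ioi) simp
    also have "\<dots> = sigma_sets UNIV ?E"
      by (rule sigma_sets_eqI) (auto intro: sigma_sets_top)
    finally show ?thesis .
  qed
  have d: "emeasure (distr leb01 borel u) {y<..} = emeasure leb01 {x \<in> space leb01. y < u x}"
    if "u \<in> borel_measurable leb01" for u :: "real \<Rightarrow> ereal" and y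
    using that by (subst emeasure_distr) (auto intro!: arg_cong[where f="emeasure leb01"])
  show ?thesis
  proof (rule measure_eqI_generator_eq[where E="?E" and \<Omega>=UNIV and A="\<lambda>_. UNIV"])
    have "{a<..} \<inter> {b<..} = {max a b<..}" for a b :: ereal by auto
    then show "Int_stable ?E" by (auto simp: Int_stable_def)
    show "emeasure (distr leb01 borel f) X = emeasure (distr leb01 borel g) X" if "X \<in> ?E" for X
    proof (cases "X = UNIV")
      case True
      then show ?thesis by (simp add: emeasure_distr)
    next
      case False
      with that obtain y where "X = {y<..}" by auto
      then show ?thesis using eq[of y] d[of f y] d[of g y] by (simp only:) simp
    qed
    show "emeasure (distr leb01 borel f) UNIV \<noteq> \<infinity>" for i :: nat
      by (simp add: emeasure_distr space_leb01 emeasure_space_leb01)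
  qed (auto simp: gen)
qed

text \<open>The cells are {0}, {infinity} and the intervals [b^n, b^(n+1)). The first component
  keeps the three kinds apart, and the countable range is what \<open>mpres_lift\<close>
  requires.\<close>

definition geometric_index :: "real \<Rightarrow> ereal \<Rightarrow> nat \<times> int" where
  "geometric_index b y = (if y = 0 then (0, 0) else if y = \<infinity> then (1, 0) else (2, \<lfloor>log b (real_of_ereal y)\<rfloor>))"

lemma geometric_index_measurable: "geometric_index b \<in> measurable borel (count_space UNIV)"
  unfolding geometric_index_def[abs_def] log_def by measurable

text \<open>Positive reals in one cell have base b logarithms that differ by less than 1, hence a
  quotient below b.\<close>

lemma geometric_index_eq_imp_le:
  assumes b: "1 < b" and x: "0 \<le> x" and y: "0 \<le> y" and eq: "geometric_index b x = geometric_index b y"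
  shows "x \<le> ereal b * y"
proof (cases "x = 0 \<or> x = \<infinity>")
  case True
  with eq b show ?thesis by (auto simp: geometric_index_def split: if_splits)
next
  case False
  with x obtain u where u: "x = ereal u" "0 < u" by (cases x) auto
  from eq u y obtain v where v: "y = ereal v" "0 < v" by (cases y) (auto simp: geometric_index_def split: if_splits)
  have "\<lfloor>log b u\<rfloor> = \<lfloor>log b v\<rfloor>" using eq u v by (simp add: geometric_index_def)
  then have "log b u < log b v + 1" by linarith
  also have "log b v + 1 = log b (b * v)" using b v by (simp add: log_mult)
  finally have "u < b * v" using b u v by (subst (asm) log_less_cancel_iff) auto
  then show ?thesis using u v by simp
qed

text \<open>
  On \<open>(0,1)\<close> two equimeasurable functions need not be rearrangements of one another by a
  measure-preserving map, but they are so up to a factor arbitrarily close to one.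
\<close>

lemma same_rearr_obtain_mpres:
  assumes f: "f \<in> M01_plus" and h: "h \<in> M01_plus" and hf: "same_rearr h f" and b: "1 < b"
  obtains \<theta> where "\<theta> \<in> mpres" "AE x in leb01. h x \<le> ereal b * f (\<theta> x)"
proof -
  have meas: "f \<in> borel_measurable leb01" "h \<in> borel_measurable leb01"
    and nn: "AE x in leb01. 0 \<le> f x" "AE x in leb01. 0 \<le> h x"
    using f h by (auto simp: M01_plus_def M01_def)
  have d: "emeasure (distr leb01 borel u) (geometric_index b -` {c}) = emeasure leb01 {x \<in> {0<..<1}. geometric_index b (u x) = c}"
    if "u \<in> borel_measurable leb01" for u c
    using that measurable_sets[OF geometric_index_measurable, of "{c}" b]
    by (subst emeasure_distr) (auto simp: space_leb01 intro!: arg_cong[where f="emeasure leb01"])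
  have "measure leb01 {x \<in> {0<..<1}. geometric_index b (f x) = c} = measure leb01 {x \<in> {0<..<1}. geometric_index b (h x) = c}" for c
    using d[OF meas(1), of c] d[OF meas(2), of c] same_rearr_distr[OF h f hf]
    unfolding measure_def by simp
  then obtain \<theta> where \<theta>: "\<theta> \<in> mpres" "AE x in leb01. geometric_index b (f (\<theta> x)) = geometric_index b (h x)"
    using mpres_lift[of "\<lambda>x. geometric_index b (f x)" "\<lambda>x. geometric_index b (h x)"] meas geometric_index_measurable[of b]
    by (auto intro: measurable_compose)
  have "AE x in leb01. h x \<le> ereal b * f (\<theta> x)"
    using \<theta>(2) nn(2) AE_mpres[OF \<theta>(1) nn(1)] by eventually_elim (metis geometric_index_eq_imp_le[OF b])
  with \<theta>(1) show thesis by (rule that)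
qed

subsection \<open>Rearrangement-invariant norms and the Hardy operator\<close>

lemma enn2ereal_indicator: "enn2ereal (indicator A x) = indicator A x"
  by (simp add: indicator_def zero_ennreal.rep_eq one_ennreal.rep_eq)

lemma enn2ereal_in_M01_plus: "u \<in> borel_measurable leb01 \<Longrightarrow> (\<lambda>x. enn2ereal (u x)) \<in> M01_plus"
  by (simp add: M01_plus_def M01_def)

lemma e2ennreal_measurable_M01_plus: "f \<in> M01_plus \<Longrightarrow> (\<lambda>x. e2ennreal (f x)) \<in> borel_measurable leb01"
  by (auto simp: M01_plus_def M01_def)

lemma e2ennreal_mult: "0 \<le> c \<Longrightarrow> 0 \<le> x \<Longrightarrow> e2ennreal (ereal c * x) = ennreal c * e2ennreal x"
  by (cases x rule: ereal_cases; cases "c = 0")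
    (auto simp: ennreal_mult ennreal_mult_top e2ennreal_neg)

lemma e2ennreal_add: "0 \<le> x \<Longrightarrow> 0 \<le> y \<Longrightarrow> e2ennreal (x + y) = e2ennreal x + e2ennreal y"
  by (cases x; cases y) (auto simp: ennreal_plus)

context ri_function_norm
begin

text \<open>The axioms speak of extended reals that are nonnegative a.e. With values in
  \<open>ennreal\<close> nonnegativity is part of the type, and sums and products need no
  exceptional sets.\<close>

definition ennorm :: "(real \<Rightarrow> ennreal) \<Rightarrow> ennreal" where
  "ennorm u = N (\<lambda>x. enn2ereal (u x))"

abbreviation \<phi> :: "real \<Rightarrow> ennreal" where
  "\<phi> \<equiv> fundamental_function N"

lemma ennorm_mono:
  assumes "u \<in> borel_measurable leb01" "v \<in> borel_measurable leb01" "AE x in leb01. u x \<le> v x"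
  shows "ennorm u \<le> ennorm v"
  unfolding ennorm_def using assms by (intro P2) (auto simp: enn2ereal_in_M01_plus less_eq_ennreal.rep_eq)

lemma ennorm_add:
  assumes "u \<in> borel_measurable leb01" "v \<in> borel_measurable leb01"
  shows "ennorm (\<lambda>x. u x + v x) \<le> ennorm u + ennorm v"
  using P1_triangle[OF enn2ereal_in_M01_plus[OF assms(1)] enn2ereal_in_M01_plus[OF assms(2)]]
  by (simp add: ennorm_def plus_ennreal.rep_eq)

lemma ennorm_eq_0_iff:
  assumes "u \<in> borel_measurable leb01"
  shows "ennorm u = 0 \<longleftrightarrow> (AE x in leb01. u x = 0)"
proof -
  have "enn2ereal y = 0 \<longleftrightarrow> y = 0" for y by (metis enn2ereal_inject zero_ennreal.rep_eq)
  then show ?thesis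
    using P1_zero[OF enn2ereal_in_M01_plus[OF assms]] by (simp add: ennorm_def)
qed

text \<open>The scaling axiom covers finite factors only; the infinite one is reached through
  integer multiples. It cannot be excluded, since the factors will be integrals that may
  diverge.\<close>

lemma ennorm_cmult:
  assumes u: "u \<in> borel_measurable leb01"
  shows "ennorm (\<lambda>x. c * u x) = c * ennorm u"
proof -
  have fin: "ennorm (\<lambda>x. ennreal r * u x) = ennreal r * ennorm u" if "0 \<le> r" for r
    using P1_scale[OF enn2ereal_in_M01_plus[OF u] that] that
    by (simp add: ennorm_def times_ennreal.rep_eq)
  show ?thesis
  proof (cases c)
    case (real r) then show ?thesis using fin by simp
  next
    case top
    show ?thesis
    proof (cases "ennorm u = 0")
      case True
      with u have "AE x in leb01. u x = 0" by (simp add: ennorm_eq_0_iff)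
      then have "AE x in leb01. c * u x = 0" by eventually_elim simp
      then have "ennorm (\<lambda>x. c * u x) = 0" using u by (subst ennorm_eq_0_iff) auto
      with True show ?thesis by simp
    next
      case False
      have "of_nat n * ennorm u \<le> ennorm (\<lambda>x. c * u x)" for n
        using fin[of "real n"] u top
        by (auto simp: ennreal_of_nat_eq_real_of_nat intro!: ennorm_mono mult_right_mono simp flip: fin)
      then have "(SUP n. of_nat n * ennorm u) \<le> ennorm (\<lambda>x. c * u x)" by (rule SUP_least)
      moreover have "(SUP n. of_nat n * ennorm u) = (SUP n. of_nat n) * ennorm u"
        by (rule SUP_mult_right_ennreal[symmetric])
      moreover have "(SUP n. of_nat n :: ennreal) * ennorm u = top"
        using False by (simp add: ennreal_SUP_of_nat_eq_top ennreal_top_mult)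
      ultimately show ?thesis using False top by (simp add: ennreal_top_mult top_unique)
    qed
  qed
qed

lemma ennorm_SUP:
  fixes F :: "nat \<Rightarrow> real \<Rightarrow> ennreal"
  assumes F: "\<And>j. F j \<in> borel_measurable leb01" and v: "v \<in> borel_measurable leb01"
    and inc: "AE x in leb01. incseq (\<lambda>j. F j x) \<and> v x = (SUP j. F j x)"
  shows "ennorm v = (SUP j. ennorm (F j))"
proof -
  have "incseq (\<lambda>j. N (\<lambda>x. enn2ereal (F j x))) \<and> (\<lambda>j. N (\<lambda>x. enn2ereal (F j x))) \<longlonglongrightarrow> N (\<lambda>x. enn2ereal (v x))"
  proof (rule P3)
    show "AE x in leb01. incseq (\<lambda>j. enn2ereal (F j x)) \<and> (\<lambda>j. enn2ereal (F j x)) \<longlonglongrightarrow> enn2ereal (v x)"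
      using inc
    proof eventually_elim
      case (elim x)
      then have "(\<lambda>j. F j x) \<longlonglongrightarrow> v x" using LIMSEQ_SUP[of "\<lambda>j. F j x"] by simp
      then show ?case using elim
        by (auto simp: incseq_def less_eq_ennreal.rep_eq intro!: tendsto_enn2erealI)
    qed
  qed (use F v in \<open>auto simp: enn2ereal_in_M01_plus\<close>)
  then show ?thesis unfolding ennorm_def using LIMSEQ_SUP LIMSEQ_unique by blast
qed

lemma ennorm_sum_le:
  assumes "finite A" "\<And>i. i \<in> A \<Longrightarrow> u i \<in> borel_measurable leb01"
  shows "ennorm (\<lambda>x. \<Sum>i\<in>A. u i x) \<le> (\<Sum>i\<in>A. ennorm (u i))"
  using assms
proof (induction rule: finite_induct)
  case empty
  then show ?case using ennorm_eq_0_iff[of "\<lambda>_. 0"] by simp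
next
  case (insert i A)
  have "ennorm (\<lambda>x. u i x + (\<Sum>i\<in>A. u i x)) \<le> ennorm (u i) + ennorm (\<lambda>x. \<Sum>i\<in>A. u i x)"
    using insert.prems by (intro ennorm_add borel_measurable_sum) auto
  also have "\<dots> \<le> ennorm (u i) + (\<Sum>i\<in>A. ennorm (u i))"
    using insert by (intro add_left_mono) auto
  finally show ?case using insert.hyps by simp
qed

lemma ennorm_indicator:
  assumes "A \<in> sets leb01"
  shows "ennorm (indicator A) = \<phi> (measure leb01 A)"
  using fundamental_function_eq[OF assms refl] by (simp add: ennorm_def enn2ereal_indicator)

lemma initial_interval:
  assumes "0 \<le> s" "s \<le> 1"
  shows "{0<..<s} \<in> sets leb01" "measure leb01 {0<..<s} = s"
proof -
  have "{0<..<s} \<subseteq> {0<..<1}" using assms by auto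
  from measure_leb01[OF this] this assms show "{0<..<s} \<in> sets leb01" "measure leb01 {0<..<s} = s"
    by (simp_all only: sets_leb01_iff) auto
qed

lemma ennorm_initial: "0 \<le> s \<Longrightarrow> s \<le> 1 \<Longrightarrow> ennorm (indicator {0<..<s}) = \<phi> s"
  by (simp add: ennorm_indicator initial_interval)

lemma fundamental_mono:
  assumes "0 \<le> s" "s \<le> t" "t \<le> 1"
  shows "\<phi> s \<le> \<phi> t"
proof -
  have "ennorm (indicator {0<..<s}) \<le> ennorm (indicator {0<..<t})"
    using assms initial_interval[of s] initial_interval[of t]
    by (intro ennorm_mono) (auto simp: indicator_def intro!: AE_I2)
  then show ?thesis using assms by (simp add: ennorm_initial)
qed

lemma fundamental_finite:
  assumes "0 \<le> t" "t \<le> 1"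
  shows "\<phi> t < \<infinity>"
proof -
  have "\<phi> t \<le> ennorm (\<lambda>x. 1)"
    using assms initial_interval[of t] unfolding ennorm_initial[OF assms, symmetric]
    by (intro ennorm_mono) (auto simp: indicator_def intro!: AE_I2)
  also have "\<dots> < \<infinity>" using P4 by (simp add: ennorm_def one_ennreal.rep_eq)
  finally show ?thesis .
qed

lemma fundamental_pos:
  assumes "0 < t" "t \<le> 1"
  shows "0 < \<phi> t"
proof (rule ccontr)
  assume "\<not> 0 < \<phi> t"
  then have "ennorm (indicator {0<..<t}) = 0" using assms ennorm_initial[of t] by (simp add: zero_less_iff_neq_zero)
  then have "AE x in leb01. indicator {0<..<t} x = (0::ennreal)"
    using initial_interval[of t] assms by (subst (asm) ennorm_eq_0_iff) auto
  then have "AE x in leb01. x \<in> {0<..<t} \<longleftrightarrow> x \<in> {}" by eventually_elim (auto simp: indicator_def)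
  then have "measure leb01 {0<..<t} = measure leb01 {}"
    using initial_interval[of t] assms by (intro measure_eq_AE) auto
  then show False using initial_interval[of t] assms by simp
qed

end

section \<open>The tail integral as a positive linear operator\<close>

definition hardy :: "(real \<Rightarrow> ennreal) \<Rightarrow> real \<Rightarrow> ennreal" where
  "hardy k \<tau> = (\<integral>\<^sup>+ s. k s * indicator {\<tau><..} s \<partial>leb01)"

text \<open>Tonelli's theorem for the kernel equal to k(s) when \<tau> < s and to 0
  otherwise.\<close>

lemma hardy_measurable:
  assumes "k \<in> borel_measurable leb01"
  shows "hardy k \<in> borel_measurable leb01"
proof -
  interpret finite_measure leb01 by (rule finite_measure_leb01)
  have [measurable]: "k \<in> borel_measurable leb01" by fact
  have "(\<lambda>x. x) \<in> borel_measurable leb01"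
    by (intro measurable_restrict_space1 measurable_completion) auto
  then have [measurable]: "fst \<in> borel_measurable (leb01 \<Otimes>\<^sub>M leb01)" "snd \<in> borel_measurable (leb01 \<Otimes>\<^sub>M leb01)"
    by (auto intro: measurable_compose[OF measurable_fst] measurable_compose[OF measurable_snd])
  have "hardy k = (\<lambda>\<tau>. \<integral>\<^sup>+ s. (\<lambda>(\<tau>, s). if \<tau> < s then k s else 0) (\<tau>, s) \<partial>leb01)"
    unfolding hardy_def by (intro ext nn_integral_cong) (auto simp: indicator_def)
  also have "\<dots> \<in> borel_measurable leb01"
  proof (rule borel_measurable_nn_integral_fst)
    have "(\<lambda>z. if fst z < snd z then k (snd z) else 0) \<in> borel_measurable (leb01 \<Otimes>\<^sub>M leb01)"
      by measurable
    then show "(\<lambda>(\<tau>, s). if \<tau> < s then k s else 0) \<in> borel_measurable (leb01 \<Otimes>\<^sub>M leb01)"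
      by (simp add: case_prod_beta')
  qed
  finally show ?thesis .
qed

lemma indicator_greater_measurable: "(indicator {\<tau><..} :: real \<Rightarrow> ennreal) \<in> borel_measurable leb01"
  by (intro measurable_restrict_space1 measurable_completion) auto

lemma hardy_mono: "AE x in leb01. k x \<le> l x \<Longrightarrow> hardy k \<tau> \<le> hardy l \<tau>"
  unfolding hardy_def by (rule nn_integral_mono_AE, erule eventually_mono) (rule mult_right_mono, auto)

lemma hardy_add:
  assumes "k \<in> borel_measurable leb01" "l \<in> borel_measurable leb01"
  shows "hardy (\<lambda>x. k x + l x) \<tau> = hardy k \<tau> + hardy l \<tau>"
  using assms indicator_greater_measurable[of \<tau>] unfolding hardy_def
  by (subst nn_integral_add[symmetric]) (auto simp: distrib_right)

lemma hardy_cmult: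
  assumes "k \<in> borel_measurable leb01"
  shows "hardy (\<lambda>x. c * k x) \<tau> = c * hardy k \<tau>"
  using assms indicator_greater_measurable[of \<tau>] unfolding hardy_def
  by (subst nn_integral_cmult[symmetric]) (auto simp: mult.assoc)

lemma hardy_SUP:
  fixes F :: "nat \<Rightarrow> real \<Rightarrow> ennreal"
  assumes F: "\<And>j. F j \<in> borel_measurable leb01"
    and inc: "AE x in leb01. incseq (\<lambda>j. F j x) \<and> v x = (SUP j. F j x)"
  shows "hardy v \<tau> = (SUP j. hardy (F j) \<tau>)"
proof -
  have "hardy v \<tau> = (\<integral>\<^sup>+ s. (SUP j. F j s * indicator {\<tau><..} s) \<partial>leb01)"
    unfolding hardy_def using inc
    by (intro nn_integral_cong_AE, eventually_elim) (auto simp: SUP_mult_right_ennreal)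
  also have "\<dots> = (SUP j. hardy (F j) \<tau>)"
    unfolding hardy_def
  proof (rule nn_integral_monotone_convergence_SUP_AE)
    show "AE x in leb01. F i x * indicator {\<tau><..} x \<le> F (Suc i) x * indicator {\<tau><..} x" for i
      using inc by eventually_elim (auto intro!: mult_right_mono simp: incseq_Suc_iff)
  qed (use F indicator_greater_measurable[of \<tau>] in auto)
  finally show ?thesis .
qed

subsection \<open>Minkowski inequality and the optimal norm\<close>

lemma nn_integral_leb01: "(\<integral>\<^sup>+ x. f x \<partial>leb01) = (\<integral>\<^sup>+ x\<in>{0<..<1}. f x \<partial>lebesgue)"
  by (rule nn_integral_restrict_space) auto

text \<open>Superlevel sets are closed downwards, hence empty, the whole line, or a left ray with or
  without its endpoint.\<close>

lemma antimono_borel_measurable: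
  fixes f :: "real \<Rightarrow> 'a::{linorder_topology, second_countable_topology}"
  assumes "antimono f"
  shows "f \<in> borel_measurable borel"
proof (rule borel_measurableI_greater)
  fix y
  let ?S = "{x. y < f x}"
  have down: "x' \<in> ?S" if "x \<in> ?S" "x' \<le> x" for x x'
    using that antimonoD[OF assms that(2)] by auto
  consider "?S = {}" | "?S = UNIV" | "?S \<noteq> {}" "?S \<noteq> UNIV" by blast
  then have "?S \<in> sets borel"
  proof cases
    case 3
    then obtain b where b: "b \<notin> ?S" by blast
    have "x \<le> b" if "x \<in> ?S" for x using down[OF that, of b] b by force
    then have bdd: "bdd_above ?S" by (rule bdd_aboveI)
    have low: "x \<in> ?S" if "x < Sup ?S" for x
      using less_cSupD[OF 3(1) that] down by force
    have up: "x \<le> Sup ?S" if "x \<in> ?S" for x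
      using cSup_upper[OF that bdd] .
    have "?S = {..Sup ?S} \<or> ?S = {..<Sup ?S}"
    proof (cases "Sup ?S \<in> ?S")
      case True
      then have "?S = {..Sup ?S}" using low up by (intro set_eqI iffI) (auto simp: le_less)
      then show ?thesis by simp
    next
      case False
      then have "?S = {..<Sup ?S}" using low up by (intro set_eqI iffI) (force simp: le_less)+
      then show ?thesis by simp
    qed
    then show ?thesis by (metis borel_closed borel_open closed_atMost open_lessThan)
  qed simp_all
  then show "{x \<in> space borel. y < f x} \<in> sets borel" by simp
qed

text \<open>The cells are (i/2^n, (i+1)/2^n]. Taking the ceiling minus 1 instead of the floor puts
  the left endpoint strictly below s.\<close>

definition dyadic_index :: "nat \<Rightarrow> real \<Rightarrow> nat" where
  "dyadic_index n s = nat (\<lceil>2 ^ n * s\<rceil> - 1)"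

lemma dyadic_index:
  assumes "0 < s" "s < 1"
  shows "dyadic_index n s < 2 ^ n" "real (dyadic_index n s) / 2 ^ n < s" "s - 1 / 2 ^ n \<le> real (dyadic_index n s) / 2 ^ n"
    "real (dyadic_index n s) / 2 ^ n \<le> real (dyadic_index (Suc n) s) / 2 ^ Suc n"
proof -
  let ?c = "\<lambda>n. \<lceil>2 ^ n * s\<rceil>"
  have pos: "1 \<le> ?c n" for n using assms by (simp add: less_ceiling_iff)
  have r: "real (dyadic_index n s) = of_int (?c n) - 1" for n
    using pos[of n] by (simp add: dyadic_index_def)
  have b: "of_int (?c n) < 2 ^ n * s + 1" "2 ^ n * s \<le> of_int (?c n)" for n
    using ceiling_correct[of "2 ^ n * s"] le_of_int_ceiling[of "2 ^ n * s"] by simp_all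
  have "real (dyadic_index n s) < 2 ^ n * s" using r[of n] b[of n] by simp
  also have "2 ^ n * s < 2 ^ n" using assms by simp
  finally have "real (dyadic_index n s) < real (2 ^ n)" by simp
  then show "dyadic_index n s < 2 ^ n" by (simp only: of_nat_less_iff)
  show "real (dyadic_index n s) / 2 ^ n < s"
    using r[of n] b(1)[of n] by (simp add: field_simps)
  have "(2 ^ n * s - 1) / 2 ^ n \<le> real (dyadic_index n s) / 2 ^ n"
    using r[of n] b(2)[of n] by (intro divide_right_mono) auto
  then show "s - 1 / 2 ^ n \<le> real (dyadic_index n s) / 2 ^ n"
    by (simp add: diff_divide_distrib)
  have "2 * (of_int (?c n) - 1) < 2 * (2 ^ n * s)" using b(1)[of n] by simp
  also have "\<dots> = 2 ^ Suc n * s" by simp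
  also have "\<dots> \<le> of_int (?c (Suc n))" by (rule b)
  finally have "real_of_int (2 * (?c n - 1)) < real_of_int (?c (Suc n))" by simp
  \<comment> \<open>A strict inequality between integers leaves a gap of 1. This is just enough to
    make the left endpoints increase under refinement.\<close>
  then have "2 * (?c n - 1) + 1 \<le> ?c (Suc n)" by (simp only: of_int_less_iff)
  then have "real_of_int (2 * (?c n - 1) + 1) \<le> real_of_int (?c (Suc n))" by (simp only: of_int_le_iff)
  then have "2 * real (dyadic_index n s) \<le> real (dyadic_index (Suc n) s)" unfolding r by simp
  then show "real (dyadic_index n s) / 2 ^ n \<le> real (dyadic_index (Suc n) s) / 2 ^ Suc n"
    by (simp add: field_simps)
qed

lemma ident_measurable_leb01: "(\<lambda>x. x) \<in> borel_measurable leb01"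
  by (intro measurable_restrict_space1 measurable_completion) auto

lemma dyadic_index_measurable: "dyadic_index n \<in> measurable leb01 (count_space UNIV)"
proof -
  note [measurable] = ident_measurable_leb01
  show ?thesis unfolding dyadic_index_def[abs_def] by measurable
qed

context ri_function_norm
begin

text \<open>
  Minkowski's inequality for \<open>hardy k = \<integral> k(s) \<chi>\<^bsub>(0,s)\<^esub> ds\<close>: rounding \<open>s\<close> down to a dyadic grid turns the integral
  into a finite sum and increases to the original as the grid is refined.
\<close>

lemma norm_hardy_le:
  assumes k: "k \<in> borel_measurable leb01"
  shows "ennorm (hardy k) \<le> (\<integral>\<^sup>+ s. k s * \<phi> s \<partial>leb01)"
proof -
  note [measurable] = k ident_measurable_leb01 dyadic_index_measurable
  define d where "d n s = real (dyadic_index n s) / 2 ^ n" for n s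
  define K where "K n i = (\<integral>\<^sup>+ s. k s * (if dyadic_index n s = i then 1 else 0) \<partial>leb01)" for n i
  \<comment> \<open>With \<open>K n i\<close> the mass of k on cell i, this is the integral with s
    rounded down, written as a finite combination of indicators, to which the finite triangle
    inequality applies.\<close>
  define T where "T n \<tau> = (\<Sum>i<2 ^ n. K n i * indicator {0<..<real i / 2 ^ n} \<tau>)" for n \<tau>
  have i01: "{0<..<real i / 2 ^ n} \<in> sets leb01" if "i < 2 ^ n" for i n :: nat
    using that by (intro initial_interval) (auto simp: field_simps)
  have T_meas: "T n \<in> borel_measurable leb01" for n
    unfolding T_def[abs_def] using i01 by (intro borel_measurable_sum borel_measurable_times) auto
  have T_eq: "T n \<tau> = (\<integral>\<^sup>+ s. k s * (if \<tau> < d n s then 1 else 0) \<partial>leb01)" if "0 < \<tau>" for n \<tau>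
  proof -
    have "T n \<tau> = (\<Sum>i<2 ^ n. \<integral>\<^sup>+ s. k s * (if dyadic_index n s = i then 1 else 0) * indicator {0<..<real i / 2 ^ n} \<tau> \<partial>leb01)"
      unfolding T_def K_def by (intro sum.cong refl nn_integral_multc[symmetric]) measurable
    also have "\<dots> = (\<integral>\<^sup>+ s. (\<Sum>i<2 ^ n. k s * (if dyadic_index n s = i then 1 else 0) * indicator {0<..<real i / 2 ^ n} \<tau>) \<partial>leb01)"
      by (rule nn_integral_sum[symmetric]) measurable
    also have "\<dots> = (\<integral>\<^sup>+ s. k s * (if \<tau> < d n s then 1 else 0) \<partial>leb01)"
    proof (rule nn_integral_cong)
      fix s assume "s \<in> space leb01"
      then have s: "0 < s" "s < 1" by (auto simp: space_leb01)
      have "(\<Sum>i<2 ^ n. k s * (if dyadic_index n s = i then 1 else 0) * indicator {0<..<real i / 2 ^ n} \<tau>)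
          = (\<Sum>i<2 ^ n. if dyadic_index n s = i then k s * indicator {0<..<real i / 2 ^ n} \<tau> else 0)"
        by (intro sum.cong) auto
      also have "\<dots> = k s * (if \<tau> < d n s then 1 else 0)"
        using dyadic_index(1)[OF s, of n] that by (simp add: sum.delta' d_def indicator_def)
      finally show "(\<Sum>i<2 ^ n. k s * (if dyadic_index n s = i then 1 else 0) * indicator {0<..<real i / 2 ^ n} \<tau>)
          = k s * (if \<tau> < d n s then 1 else 0)" .
    qed
    finally show ?thesis .
  qed
  have le: "ennorm (T n) \<le> (\<integral>\<^sup>+ s. k s * \<phi> s \<partial>leb01)" for n
  proof -
    have "ennorm (T n) \<le> (\<Sum>i<2 ^ n. ennorm (\<lambda>\<tau>. K n i * indicator {0<..<real i / 2 ^ n} \<tau>))"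
      unfolding T_def[abs_def] using i01 by (intro ennorm_sum_le borel_measurable_times) auto
    also have "\<dots> = (\<Sum>i<2 ^ n. K n i * \<phi> (real i / 2 ^ n))"
    proof (intro sum.cong refl)
      fix i :: nat assume "i \<in> {..<2 ^ n}"
      then have i: "i < 2 ^ n" by simp
      then have "real i \<le> 2 ^ n" by (metis less_imp_le of_nat_le_iff of_nat_numeral of_nat_power)
      with i01[OF i] show "ennorm (\<lambda>\<tau>. K n i * indicator {0<..<real i / 2 ^ n} \<tau>) = K n i * \<phi> (real i / 2 ^ n)"
        by (subst ennorm_cmult) (auto simp: ennorm_initial)
    qed
    also have "\<dots> = (\<Sum>i<2 ^ n. \<integral>\<^sup>+ s. k s * (if dyadic_index n s = i then 1 else 0) * \<phi> (real i / 2 ^ n) \<partial>leb01)"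
      unfolding K_def by (intro sum.cong refl nn_integral_multc[symmetric]) measurable
    also have "\<dots> = (\<integral>\<^sup>+ s. (\<Sum>i<2 ^ n. k s * (if dyadic_index n s = i then 1 else 0) * \<phi> (real i / 2 ^ n)) \<partial>leb01)"
      by (rule nn_integral_sum[symmetric]) measurable
    \<comment> \<open>Rounding down can only decrease \<phi>, so the bound holds uniformly in n and
      survives the limit.\<close>
    also have "\<dots> \<le> (\<integral>\<^sup>+ s. k s * \<phi> s \<partial>leb01)"
    proof (rule nn_integral_mono)
      fix s assume "s \<in> space leb01"
      then have s: "0 < s" "s < 1" by (auto simp: space_leb01)
      have "(\<Sum>i<2 ^ n. k s * (if dyadic_index n s = i then 1 else 0) * \<phi> (real i / 2 ^ n))
          = (\<Sum>i<2 ^ n. if dyadic_index n s = i then k s * \<phi> (real i / 2 ^ n) else 0)"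
        by (intro sum.cong) auto
      also have "\<dots> = k s * \<phi> (d n s)"
        using dyadic_index(1)[OF s, of n] by (simp add: sum.delta' d_def)
      also have "\<dots> \<le> k s * \<phi> s"
        using dyadic_index(2)[OF s, of n] s by (intro mult_left_mono fundamental_mono) (auto simp: d_def)
      finally show "(\<Sum>i<2 ^ n. k s * (if dyadic_index n s = i then 1 else 0) * \<phi> (real i / 2 ^ n)) \<le> k s * \<phi> s" .
    qed
    finally show ?thesis .
  qed
  have "ennorm (hardy k) = (SUP n. ennorm (T n))"
  proof (rule ennorm_SUP[OF T_meas hardy_measurable[OF k]], rule AE_I2)
    fix \<tau> assume "\<tau> \<in> space leb01"
    then have \<tau>: "0 < \<tau>" "\<tau> < 1" by (auto simp: space_leb01)
    have d_inc: "d n s \<le> d m s" if "0 < s" "s < 1" "n \<le> m" for n m s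
    proof (rule lift_Suc_mono_le[of "\<lambda>n. d n s", OF _ that(3)])
      show "d i s \<le> d (Suc i) s" for i unfolding d_def using that by (intro dyadic_index(4))
    qed
    have "incseq (\<lambda>n. T n \<tau>)"
      unfolding T_eq[OF \<tau>(1)]
    proof (rule incseq_SucI, rule nn_integral_mono)
      fix n s assume "s \<in> space leb01"
      then show "k s * (if \<tau> < d n s then 1 else 0) \<le> k s * (if \<tau> < d (Suc n) s then 1 else 0)"
        using d_inc[of s n "Suc n"] by (intro mult_left_mono) (auto simp: space_leb01)
    qed
    moreover have "hardy k \<tau> = (SUP n. T n \<tau>)"
    proof -
      have "hardy k \<tau> = (\<integral>\<^sup>+ s. (SUP n. k s * (if \<tau> < d n s then 1 else 0)) \<partial>leb01)"
        unfolding hardy_def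
      proof (rule nn_integral_cong)
        fix s assume "s \<in> space leb01"
        then have s: "0 < s" "s < 1" by (auto simp: space_leb01)
        show "k s * indicator {\<tau><..} s = (SUP n. k s * (if \<tau> < d n s then 1 else 0))"
        proof (cases "\<tau> < s")
          case False
          then have "\<not> \<tau> < d n s" for n using dyadic_index(2)[OF s, of n] by (simp add: d_def)
          with False show ?thesis by simp
        next
          case True
          obtain n where n: "(1 / 2) ^ n < s - \<tau>"
            using real_arch_pow_inv[of "s - \<tau>" "1/2"] True by auto
          then have "\<tau> < d n s" using dyadic_index(3)[OF s, of n] by (simp add: d_def power_one_over)
          then have "k s \<le> (SUP n. k s * (if \<tau> < d n s then 1 else 0))"
            by (intro SUP_upper2[of n]) auto
          moreover have "(SUP n. k s * (if \<tau> < d n s then 1 else 0)) \<le> k s"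
            by (rule SUP_least) auto
          ultimately show ?thesis using True by (simp add: indicator_def)
        qed
      qed
      also have "\<dots> = (SUP n. \<integral>\<^sup>+ s. k s * (if \<tau> < d n s then 1 else 0) \<partial>leb01)"
      proof (rule nn_integral_monotone_convergence_SUP_AE)
        show "AE s in leb01. k s * (if \<tau> < d n s then 1 else 0) \<le> k s * (if \<tau> < d (Suc n) s then 1 else 0)" for n
        proof (rule AE_I2)
          fix s assume "s \<in> space leb01"
          then show "k s * (if \<tau> < d n s then 1 else 0) \<le> k s * (if \<tau> < d (Suc n) s then 1 else 0)"
            using d_inc[of s n "Suc n"] by (intro mult_left_mono) (auto simp: space_leb01)
        qed
        show "(\<lambda>s. k s * (if \<tau> < d n s then 1 else 0)) \<in> borel_measurable leb01" for n
          unfolding d_def by measurable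
      qed
      finally show ?thesis unfolding T_eq[OF \<tau>(1)] .
    qed
    ultimately show "incseq (\<lambda>n. T n \<tau>) \<and> hardy k \<tau> = (SUP n. T n \<tau>)" by blast
  qed
  also have "\<dots> \<le> (\<integral>\<^sup>+ s. k s * \<phi> s \<partial>leb01)"
    by (rule SUP_least) (rule le)
  finally show ?thesis .
qed

text \<open>A tail integral is non-increasing in \<tau>, so on (0,b) it dominates its value at b
  times the indicator of (0,b).\<close>

lemma norm_hardy_ge:
  assumes k: "k \<in> borel_measurable leb01" and b: "0 \<le> b" "b \<le> 1"
  shows "\<phi> b * hardy k b \<le> ennorm (hardy k)"
proof -
  have "ennorm (\<lambda>\<tau>. hardy k b * indicator {0<..<b} \<tau>) \<le> ennorm (hardy k)"
  proof (rule ennorm_mono)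
    have "hardy k b * indicator {0<..<b} \<tau> \<le> hardy k \<tau>" for \<tau>
      unfolding hardy_def
      by (cases "\<tau> \<in> {0<..<b}") (auto intro!: nn_integral_mono mult_left_mono simp: indicator_def)
    then show "AE \<tau> in leb01. hardy k b * indicator {0<..<b} \<tau> \<le> hardy k \<tau>" by simp
  qed (use k b hardy_measurable initial_interval in auto)
  then show ?thesis
    using b initial_interval[OF b] by (simp add: ennorm_cmult ennorm_initial mult.commute)
qed

end

section \<open>The norm over all measure-preserving rearrangements, for an abstract weight w in
  place of 1/I\<close>

locale hardy_weight = ri_function_norm N for N +
  fixes w :: "real \<Rightarrow> ennreal" and c0 :: real
  assumes w_measurable: "w \<in> borel_measurable leb01"
    and w_lower: "x \<in> {0<..<1} \<Longrightarrow> ennreal c0 \<le> w x"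
    and c0_pos: "0 < c0"
    and w_finite: "ennorm (hardy w) < \<infinity>"
begin

text \<open>The contribution of one fixed arrangement. It is not rearrangement invariant, because
  the tail integral depends on where u is large; \<open>opt_norm\<close> removes this
  dependence.\<close>

definition hardy_norm :: "(real \<Rightarrow> ennreal) \<Rightarrow> ennreal" where
  "hardy_norm u = ennorm (hardy (\<lambda>s. u s * w s))"

definition opt_norm :: "(real \<Rightarrow> ennreal) \<Rightarrow> ennreal" where
  "opt_norm u = (SUP \<theta>\<in>mpres. hardy_norm (\<lambda>x. u (\<theta> x)))"

lemma weighted_measurable: "u \<in> borel_measurable leb01 \<Longrightarrow> (\<lambda>s. u s * w s) \<in> borel_measurable leb01"
proof -
  assume [measurable]: "u \<in> borel_measurable leb01"
  note [measurable] = w_measurable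
  show "(\<lambda>s. u s * w s) \<in> borel_measurable leb01" by measurable
qed

lemma hardy_weighted_measurable: "u \<in> borel_measurable leb01 \<Longrightarrow> hardy (\<lambda>s. u s * w s) \<in> borel_measurable leb01"
  by (intro hardy_measurable weighted_measurable)

lemma comp_measurable: "u \<in> borel_measurable leb01 \<Longrightarrow> \<theta> \<in> mpres \<Longrightarrow> (\<lambda>x. u (\<theta> x)) \<in> borel_measurable leb01"
  by (rule measurable_compose[OF mpres_measurable])

lemma hardy_norm_mono:
  assumes "u \<in> borel_measurable leb01" "v \<in> borel_measurable leb01" "AE x in leb01. u x \<le> v x"
  shows "hardy_norm u \<le> hardy_norm v"
proof -
  have "AE x in leb01. u x * w x \<le> v x * w x"
    using assms(3) by eventually_elim (simp add: mult_right_mono)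
  then have "hardy (\<lambda>s. u s * w s) \<tau> \<le> hardy (\<lambda>s. v s * w s) \<tau>" for \<tau> by (rule hardy_mono)
  then show ?thesis
    unfolding hardy_norm_def using assms by (intro ennorm_mono hardy_weighted_measurable AE_I2) auto
qed

lemma hardy_norm_add:
  assumes "u \<in> borel_measurable leb01" "v \<in> borel_measurable leb01"
  shows "hardy_norm (\<lambda>x. u x + v x) \<le> hardy_norm u + hardy_norm v"
proof -
  have "hardy (\<lambda>s. (u s + v s) * w s) = (\<lambda>\<tau>. hardy (\<lambda>s. u s * w s) \<tau> + hardy (\<lambda>s. v s * w s) \<tau>)"
    using assms by (intro ext) (simp add: distrib_right hardy_add weighted_measurable)
  then show ?thesis
    unfolding hardy_norm_def using assms by (simp add: ennorm_add hardy_weighted_measurable)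
qed

lemma hardy_norm_cmult:
  assumes "u \<in> borel_measurable leb01"
  shows "hardy_norm (\<lambda>x. c * u x) = c * hardy_norm u"
proof -
  have "hardy (\<lambda>s. c * u s * w s) = (\<lambda>\<tau>. c * hardy (\<lambda>s. u s * w s) \<tau>)"
    using assms by (intro ext) (simp add: mult.assoc hardy_cmult weighted_measurable)
  then show ?thesis
    unfolding hardy_norm_def using assms by (simp add: ennorm_cmult hardy_weighted_measurable)
qed

lemma hardy_norm_SUP:
  fixes F :: "nat \<Rightarrow> real \<Rightarrow> ennreal"
  assumes F: "\<And>j. F j \<in> borel_measurable leb01" and v: "v \<in> borel_measurable leb01"
    and inc: "AE x in leb01. incseq (\<lambda>j. F j x) \<and> v x = (SUP j. F j x)"
  shows "hardy_norm v = (SUP j. hardy_norm (F j))"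
  unfolding hardy_norm_def
proof (rule ennorm_SUP)
  have 1: "AE x in leb01. incseq (\<lambda>j. F j x * w x) \<and> v x * w x = (SUP j. F j x * w x)"
    using inc by eventually_elim (auto simp: SUP_mult_right_ennreal incseq_def intro: mult_right_mono)
  have "AE x in leb01. F i x * w x \<le> F j x * w x" if "i \<le> j" for i j
    using 1 by eventually_elim (use that in \<open>auto simp: incseq_def\<close>)
  then have "incseq (\<lambda>j. hardy (\<lambda>s. F j s * w s) \<tau>)" for \<tau>
    by (auto simp: incseq_def intro: hardy_mono)
  moreover have "hardy (\<lambda>s. v s * w s) \<tau> = (SUP j. hardy (\<lambda>s. F j s * w s) \<tau>)" for \<tau>
    using F 1 by (intro hardy_SUP weighted_measurable) auto
  ultimately show "AE x in leb01. incseq (\<lambda>j. hardy (\<lambda>s. F j s * w s) x) \<and>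
      hardy (\<lambda>s. v s * w s) x = (SUP j. hardy (\<lambda>s. F j s * w s) x)"
    by (intro AE_I2) simp
qed (use F v hardy_weighted_measurable in auto)

lemma opt_norm_upper: "\<theta> \<in> mpres \<Longrightarrow> hardy_norm (\<lambda>x. u (\<theta> x)) \<le> opt_norm u"
  unfolding opt_norm_def by (rule SUP_upper)

lemma opt_norm_mono:
  assumes "u \<in> borel_measurable leb01" "v \<in> borel_measurable leb01" "AE x in leb01. u x \<le> v x"
  shows "opt_norm u \<le> opt_norm v"
  unfolding opt_norm_def
proof (rule SUP_subset_mono[OF order_refl], rule hardy_norm_mono)
  show "AE x in leb01. u (\<theta> x) \<le> v (\<theta> x)" if "\<theta> \<in> mpres" for \<theta>
    using AE_mpres[OF that assms(3)] .
qed (use assms comp_measurable in auto)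

lemma opt_norm_add:
  assumes "u \<in> borel_measurable leb01" "v \<in> borel_measurable leb01"
  shows "opt_norm (\<lambda>x. u x + v x) \<le> opt_norm u + opt_norm v"
proof (unfold opt_norm_def[of "\<lambda>x. u x + v x"], rule SUP_least)
  fix \<theta> assume \<theta>: "\<theta> \<in> mpres"
  have "hardy_norm (\<lambda>x. u (\<theta> x) + v (\<theta> x)) \<le> hardy_norm (\<lambda>x. u (\<theta> x)) + hardy_norm (\<lambda>x. v (\<theta> x))"
    by (rule hardy_norm_add[OF comp_measurable[OF assms(1) \<theta>] comp_measurable[OF assms(2) \<theta>]])
  also have "\<dots> \<le> opt_norm u + opt_norm v" by (intro add_mono opt_norm_upper[OF \<theta>])
  finally show "hardy_norm (\<lambda>x. u (\<theta> x) + v (\<theta> x)) \<le> opt_norm u + opt_norm v" .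
qed

lemma opt_norm_cmult:
  assumes "u \<in> borel_measurable leb01"
  shows "opt_norm (\<lambda>x. c * u x) = c * opt_norm u"
  unfolding opt_norm_def using assms mpres_id
  by (subst SUP_mult_left_ennreal) (auto simp: hardy_norm_cmult comp_measurable intro!: SUP_cong)

text \<open>Monotone limits pass through because the suprema over \<theta> and over j
  commute.\<close>

lemma opt_norm_SUP:
  fixes F :: "nat \<Rightarrow> real \<Rightarrow> ennreal"
  assumes F: "\<And>j. F j \<in> borel_measurable leb01" and v: "v \<in> borel_measurable leb01"
    and inc: "AE x in leb01. incseq (\<lambda>j. F j x) \<and> v x = (SUP j. F j x)"
  shows "opt_norm v = (SUP j. opt_norm (F j))"
proof -
  have "opt_norm v = (SUP \<theta>\<in>mpres. SUP j. hardy_norm (\<lambda>x. F j (\<theta> x)))"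
    unfolding opt_norm_def
  proof (intro SUP_cong refl hardy_norm_SUP)
    fix \<theta> assume \<theta>: "\<theta> \<in> mpres"
    show "AE x in leb01. incseq (\<lambda>j. F j (\<theta> x)) \<and> v (\<theta> x) = (SUP j. F j (\<theta> x))"
      using AE_mpres[OF \<theta> inc] .
  qed (use F v comp_measurable in auto)
  also have "\<dots> = (SUP j. opt_norm (F j))"
    unfolding opt_norm_def by (rule SUP_commute)
  finally show ?thesis .
qed

text \<open>Composition does not change a constant, so the supremum is over a single value: the norm
  of the tail integral of w.\<close>

lemma opt_norm_one: "opt_norm (\<lambda>_. 1) < \<infinity>"
proof -
  have "opt_norm (\<lambda>_. 1) = ennorm (hardy w)"
    unfolding opt_norm_def hardy_norm_def using mpres_id by (subst SUP_const) auto
  then show ?thesis using w_finite by simp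
qed

text \<open>At \<tau> = 1/2 the tail integral sees u on (1/2,1) with weight at least
  \<open>c0\<close>, and \<open>norm_hardy_ge\<close> at b = 1/2 contributes the factor
  \<phi>(1/2).\<close>

lemma half_integral_le_hardy_norm:
  assumes u: "u \<in> borel_measurable leb01"
  shows "ennreal c0 * \<phi> (1 / 2) * (\<integral>\<^sup>+ s. u s * indicator {1/2<..} s \<partial>leb01) \<le> hardy_norm u"
proof -
  let ?K = "\<integral>\<^sup>+ s. u s * indicator {1/2<..} s \<partial>leb01"
  have "ennreal c0 * ?K = (\<integral>\<^sup>+ s. ennreal c0 * (u s * indicator {1/2<..} s) \<partial>leb01)"
    using u indicator_greater_measurable[of "1/2"] by (intro nn_integral_cmult[symmetric]) auto
  also have "\<dots> \<le> hardy (\<lambda>s. u s * w s) (1 / 2)"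
    unfolding hardy_def
  proof (rule nn_integral_mono)
    fix s assume "s \<in> space leb01"
    then have "ennreal c0 \<le> w s" using w_lower by (simp add: space_leb01)
    then show "ennreal c0 * (u s * indicator {1/2<..} s) \<le> u s * w s * indicator {1/2<..} s"
      by (auto simp: indicator_def mult.commute[of "u s"] intro: mult_right_mono)
  qed
  finally have "\<phi> (1 / 2) * (ennreal c0 * ?K) \<le> \<phi> (1 / 2) * hardy (\<lambda>s. u s * w s) (1 / 2)"
    by (rule mult_left_mono) simp
  also have "\<dots> \<le> hardy_norm u"
    unfolding hardy_norm_def using u by (intro norm_hardy_ge weighted_measurable) auto
  finally show ?thesis by (simp add: mult_ac)
qed

text \<open>The right half of the integral is controlled through the identity map, the left half
  through the reflection. Adding the two gives the 2 in the constant 2 / (c0 * p), where p =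
  \<phi>(1/2).\<close>

lemma integral_le_opt_norm:
  obtains c where "0 < c" "\<And>u. u \<in> borel_measurable leb01 \<Longrightarrow> (\<integral>\<^sup>+ x. u x \<partial>leb01) \<le> ennreal c * opt_norm u"
proof -
  obtain p where p: "\<phi> (1 / 2) = ennreal p" "0 < p"
    using fundamental_pos[of "1/2"] fundamental_finite[of "1/2"] by (cases "\<phi> (1/2)") auto
  show thesis
  proof (rule that[of "2 / (c0 * p)"])
    show "0 < 2 / (c0 * p)" using c0_pos p by simp
    fix u :: "real \<Rightarrow> ennreal" assume u: "u \<in> borel_measurable leb01"
    have ur: "(\<lambda>x. u (1 - x)) \<in> borel_measurable leb01" using comp_measurable[OF u mpres_reflection] .
    let ?U = "\<integral>\<^sup>+ s. u s * indicator {1/2<..} s \<partial>leb01"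
    let ?V = "\<integral>\<^sup>+ s. u (1 - s) * indicator {1/2<..} s \<partial>leb01"
    let ?W = "\<integral>\<^sup>+ s. u s * indicator {..<1/2} s \<partial>leb01"
    have il: "(indicator {..<1/2} :: real \<Rightarrow> ennreal) \<in> borel_measurable leb01"
      by (intro measurable_restrict_space1 measurable_completion) auto
    have "?W = (\<integral>\<^sup>+ s. u s * indicator {..<1/2} s \<partial>distr leb01 leb01 (\<lambda>x. 1 - x))"
      using mpres_reflection by (simp only: mpres_def mem_Collect_eq)
    also have "\<dots> = (\<integral>\<^sup>+ s. u (1 - s) * indicator {..<1/2} (1 - s) \<partial>leb01)"
      using u il mpres_measurable[OF mpres_reflection] by (intro nn_integral_distr) auto
    also have "\<dots> = ?V" by (intro nn_integral_cong) (auto simp: indicator_def)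
    finally have WV: "?W = ?V" .
    have "AE x in lebesgue. x \<noteq> (1/2::real)"
      using AE_not_in[of "{1/2::real}" lebesgue] by simp
    then have ne: "AE x in leb01. x \<noteq> 1/2" unfolding AE_leb01_iff by eventually_elim simp
    have "(\<integral>\<^sup>+ x. u x \<partial>leb01) = (\<integral>\<^sup>+ s. u s * indicator {1/2<..} s + u s * indicator {..<1/2} s \<partial>leb01)"
      by (rule nn_integral_cong_AE) (use ne in \<open>eventually_elim, auto simp: indicator_def\<close>)
    also have "\<dots> = ?U + ?W"
      using u il indicator_greater_measurable[of "1/2"] by (intro nn_integral_add) auto
    finally have eq: "(\<integral>\<^sup>+ x. u x \<partial>leb01) = ?U + ?V" by (simp add: WV)
    have "ennreal (c0 * p) * ?U \<le> opt_norm u"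
      using order_trans[OF half_integral_le_hardy_norm[OF u] opt_norm_upper[OF mpres_id, of u]] c0_pos p by (simp add: ennreal_mult)
    moreover have "ennreal (c0 * p) * ?V \<le> opt_norm u"
      using order_trans[OF half_integral_le_hardy_norm[OF ur] opt_norm_upper[OF mpres_reflection, of u]] c0_pos p by (simp add: ennreal_mult)
    ultimately have "ennreal (c0 * p) * (?U + ?V) \<le> opt_norm u + opt_norm u"
      unfolding distrib_left by (rule add_mono)
    moreover have "ennreal (c0 * p) = ennreal (c0 * p / 2) + ennreal (c0 * p / 2)"
      using c0_pos p by (subst ennreal_plus[symmetric]) auto
    ultimately have double: "ennreal (c0 * p / 2) * (?U + ?V) + ennreal (c0 * p / 2) * (?U + ?V) \<le> opt_norm u + opt_norm u"
      by (simp only: distrib_right)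
    \<comment> \<open>Halving both sides is done by contradiction: strict inequalities add up in
      \<open>ennreal\<close>, so infinite values need no separate case.\<close>
    have half: "ennreal (c0 * p / 2) * (?U + ?V) \<le> opt_norm u"
    proof (rule ccontr)
      assume "\<not> ?thesis"
      then have l: "opt_norm u < ennreal (c0 * p / 2) * (?U + ?V)" by simp
      from add_strict_mono[OF l l] double show False by simp
    qed
    have "(\<integral>\<^sup>+ x. u x \<partial>leb01) = ennreal (2 / (c0 * p)) * (ennreal (c0 * p / 2) * (?U + ?V))"
      using c0_pos p unfolding eq by (subst mult.assoc[symmetric], subst ennreal_mult[symmetric]) auto
    also have "\<dots> \<le> ennreal (2 / (c0 * p)) * opt_norm u" using half by (rule mult_left_mono) simp
    finally show "(\<integral>\<^sup>+ x. u x \<partial>leb01) \<le> ennreal (2 / (c0 * p)) * opt_norm u" .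
  qed
qed

end

section \<open>Real-variable estimates for non-increasing functions\<close>

lemma inverse_ennreal_antimono:
  assumes "0 \<le> a" "a \<le> b"
  shows "1 / ennreal b \<le> 1 / ennreal a"
proof (cases "a = 0")
  case False
  then have "ennreal (1 / b) \<le> ennreal (1 / a)"
    using assms by (intro ennreal_leI divide_left_mono) auto
  with False assms show ?thesis using divide_ennreal[of 1 a] divide_ennreal[of 1 b] by simp
qed (simp add: divide_ennreal_def)

text \<open>The supremum over \<tau> > s leaves out s itself, where g may be larger. At each such s
  a point of a countable dense set fits strictly between the two values, and these points strictly
  decrease in s, so they are distinct.\<close>

lemma countable_exceeds_right_sup:
  fixes g :: "real \<Rightarrow> ennreal"
  shows "countable {s. s < b \<and> (SUP \<tau>\<in>{s<..<b}. g \<tau>) < g s}" (is "countable ?S")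
proof -
  let ?G = "\<lambda>s. SUP \<tau>\<in>{s<..<b}. g \<tau>"
  obtain D :: "ennreal set" where D: "countable D" "\<And>X. open X \<Longrightarrow> X \<noteq> {} \<Longrightarrow> \<exists>d\<in>D. d \<in> X"
    using countable_dense_setE by blast
  have "\<exists>d. d \<in> D \<and> ?G s < d \<and> d < g s" if "s \<in> ?S" for s
  proof -
    have "{?G s<..<g s} \<noteq> {}" using that dense[of "?G s" "g s"] by auto
    with D(2)[of "{?G s<..<g s}"] show ?thesis by auto
  qed
  then obtain q where q: "\<And>s. s \<in> ?S \<Longrightarrow> q s \<in> D \<and> ?G s < q s \<and> q s < g s" by metis
  have lt: "q s' < q s" if "s \<in> ?S" "s' \<in> ?S" "s < s'" for s s'
  proof -
    have "q s' < g s'" using q that by blast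
    also have "g s' \<le> ?G s" using that by (intro SUP_upper) auto
    also have "?G s < q s" using q that by blast
    finally show ?thesis .
  qed
  have "inj_on q ?S"
  proof (rule inj_onI, rule ccontr)
    fix s s' assume "s \<in> ?S" "s' \<in> ?S" "q s = q s'" "s \<noteq> s'"
    then show False using lt[of s s'] lt[of s' s] by (cases "s < s'") auto
  qed
  moreover have "q ` ?S \<subseteq> D" using q by blast
  then have "countable (q ` ?S)" using D(1) countable_subset by blast
  ultimately show ?thesis using countable_image_inj_on by blast
qed

text \<open>After removing the common part of F and (0,t), the two remainders have equal measure.
  The one from F lies at or beyond t, where G is at most G(t); the one from (0,t) lies where G is at
  least G(t).\<close>

lemma nn_integral_antimono_le_initial:
  fixes G :: "real \<Rightarrow> ennreal"
  assumes G: "antimono G" and F: "F \<in> sets leb01" "measure leb01 F = t" and t: "0 \<le> t" "t \<le> 1"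
  shows "(\<integral>\<^sup>+ s. G s * indicator F s \<partial>leb01) \<le> (\<integral>\<^sup>+ s. G s * indicator {0<..<t} s \<partial>leb01)"
proof -
  interpret finite_measure leb01 by (rule finite_measure_leb01)
  let ?A = "{0<..<t}"
  have "{0<..<t} \<subseteq> {0<..<1}" using t by auto
  then have A: "?A \<in> sets leb01" "measure leb01 ?A = t"
    using t by (simp_all only: sets_leb01_iff measure_leb01) auto
  have [measurable]: "G \<in> borel_measurable leb01"
    using antimono_borel_measurable[OF G] by (intro measurable_restrict_space1 measurable_completion) auto
  note [measurable] = A(1) F(1)
  have split: "(\<integral>\<^sup>+ s. G s * indicator B s \<partial>leb01) =
      (\<integral>\<^sup>+ s. G s * indicator (B \<inter> B') s \<partial>leb01) + (\<integral>\<^sup>+ s. G s * indicator (B - B') s \<partial>leb01)"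
    if [measurable]: "B \<in> sets leb01" "B' \<in> sets leb01" for B B'
    by (subst nn_integral_add[symmetric]) (measurable, auto intro!: nn_integral_cong simp: indicator_def)
  have "measure leb01 (F - ?A) = measure leb01 (?A - F)"
    using A F by (simp add: finite_measure_Diff' Int_commute)
  then have eq: "emeasure leb01 (F - ?A) = emeasure leb01 (?A - F)" by (rule emeasure_leb01_eqI)
  have "(\<integral>\<^sup>+ s. G s * indicator (F - ?A) s \<partial>leb01) \<le> (\<integral>\<^sup>+ s. G t * indicator (F - ?A) s \<partial>leb01)"
  proof (rule nn_integral_mono)
    fix s assume "s \<in> space leb01"
    then show "G s * indicator (F - ?A) s \<le> G t * indicator (F - ?A) s"
      using antimonoD[OF G, of t s] by (auto simp: indicator_def space_leb01)
  qed
  also have "\<dots> = G t * emeasure leb01 (?A - F)"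
    using eq by (subst nn_integral_cmult_indicator) auto
  also have "\<dots> = (\<integral>\<^sup>+ s. G t * indicator (?A - F) s \<partial>leb01)"
    by (subst nn_integral_cmult_indicator) auto
  also have "\<dots> \<le> (\<integral>\<^sup>+ s. G s * indicator (?A - F) s \<partial>leb01)"
    using antimonoD[OF G, of _ t] by (intro nn_integral_mono) (auto simp: indicator_def)
  finally have "(\<integral>\<^sup>+ s. G s * indicator (F - ?A) s \<partial>leb01) \<le> (\<integral>\<^sup>+ s. G s * indicator (?A - F) s \<partial>leb01)" .
  then show ?thesis
    using split[OF F(1) A(1)] split[OF A(1) F(1)] by (simp add: Int_commute add_left_mono)
qed

text \<open>The mean of a non-increasing function does not grow when the interval is extended to the
  right, as comparing both pieces with the value w(b) shows. The means are cross-multiplied so that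
  infinite integrals are harmless.\<close>

lemma antimono_integral_average:
  fixes w :: "real \<Rightarrow> ennreal"
  assumes w: "w \<in> borel_measurable leb01"
    and anti: "\<And>x y. 0 < x \<Longrightarrow> x \<le> y \<Longrightarrow> y < 1 \<Longrightarrow> w y \<le> w x"
    and abc: "0 < a" "a < b" "b < c" "c \<le> 1"
  shows "ennreal (b - a) * (\<integral>\<^sup>+ s. w s * indicator {a<..<c} s \<partial>leb01)
    \<le> ennreal (c - a) * (\<integral>\<^sup>+ s. w s * indicator {a<..<b} s \<partial>leb01)"
proof -
  let ?J = "\<integral>\<^sup>+ s. w s * indicator {a<..<b} s \<partial>leb01"
  have sub: "{a<..<b} \<subseteq> {0<..<1}" "{b..<c} \<subseteq> {0<..<1}" using abc by auto
  then have s: "{a<..<b} \<in> sets leb01" "{b..<c} \<in> sets leb01"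
    and e: "emeasure leb01 {a<..<b} = ennreal (b - a)" "emeasure leb01 {b..<c} = ennreal (c - b)"
    using abc by (simp_all only: sets_leb01_iff emeasure_leb01) auto
  note [measurable] = w s
  have "(\<integral>\<^sup>+ s. w s * indicator {b..<c} s \<partial>leb01) \<le> (\<integral>\<^sup>+ s. w b * indicator {b..<c} s \<partial>leb01)"
    using abc anti[of b] by (intro nn_integral_mono) (auto simp: indicator_def)
  then have 1: "(\<integral>\<^sup>+ s. w s * indicator {b..<c} s \<partial>leb01) \<le> w b * ennreal (c - b)"
    using s e by (simp add: nn_integral_cmult_indicator)
  have "(\<integral>\<^sup>+ s. w b * indicator {a<..<b} s \<partial>leb01) \<le> ?J"
    using abc anti[of _ b] by (intro nn_integral_mono) (auto simp: indicator_def)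
  then have 2: "w b * ennreal (b - a) \<le> ?J"
    using s e by (simp add: nn_integral_cmult_indicator)
  have "(\<integral>\<^sup>+ s. w s * indicator {a<..<c} s \<partial>leb01)
      = (\<integral>\<^sup>+ s. w s * indicator {a<..<b} s + w s * indicator {b..<c} s \<partial>leb01)"
    using abc by (intro nn_integral_cong) (auto simp: indicator_def)
  also have "\<dots> = ?J + (\<integral>\<^sup>+ s. w s * indicator {b..<c} s \<partial>leb01)"
    by (rule nn_integral_add) measurable
  also have "\<dots> \<le> ?J + w b * ennreal (c - b)"
    using 1 by (rule add_left_mono)
  finally have "ennreal (b - a) * (\<integral>\<^sup>+ s. w s * indicator {a<..<c} s \<partial>leb01)
      \<le> ennreal (b - a) * (?J + w b * ennreal (c - b))"
    by (rule mult_left_mono) simp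
  also have "\<dots> = ennreal (b - a) * ?J + ennreal (c - b) * (w b * ennreal (b - a))"
    by (simp add: distrib_left mult_ac)
  also have "\<dots> \<le> ennreal (b - a) * ?J + ennreal (c - b) * ?J"
    using 2 by (intro add_left_mono mult_left_mono) auto
  also have "\<dots> = ennreal (c - a) * ?J"
    using abc by (simp add: distrib_right[symmetric] ennreal_plus[symmetric] del: ennreal_plus)
  finally show ?thesis .
qed

section \<open>Identification of the X norm and its axioms\<close>

lemma M01_plus_cong:
  assumes f: "f \<in> M01_plus" and fg: "\<And>x. x \<in> {0<..<1} \<Longrightarrow> f x = g x"
  shows "g \<in> M01_plus"
proof -
  have "f \<in> borel_measurable leb01 \<longleftrightarrow> g \<in> borel_measurable leb01"
    by (rule measurable_cong) (use fg in \<open>simp add: space_leb01\<close>)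
  moreover have "(AE x in leb01. 0 \<le> f x) \<longleftrightarrow> (AE x in leb01. 0 \<le> g x)"
    by (rule AE_cong) (use fg in \<open>simp add: space_leb01\<close>)
  ultimately show ?thesis using f by (simp only: M01_plus_def M01_def) blast
qed

lemma (in ri_function_norm) N_cong:
  assumes f: "f \<in> M01_plus" and fg: "\<And>x. x \<in> {0<..<1} \<Longrightarrow> f x = g x"
  shows "N f = N g"
proof -
  have g: "g \<in> M01_plus" by (rule M01_plus_cong[OF f fg])
  show ?thesis
    by (intro antisym P2 f g AE_I2) (use fg in \<open>auto simp: space_leb01\<close>)
qed

lemma set_integral_leb01:
  assumes "A \<subseteq> {0<..<1}"
  shows "(\<integral>\<^sup>+ x. f x * indicator A x \<partial>leb01) = (\<integral>\<^sup>+ x\<in>A. f x \<partial>lebesgue)"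
  unfolding nn_integral_leb01 using assms by (intro nn_integral_cong) (auto simp: indicator_def)

lemma hardy_eq_lebesgue:
  assumes "0 \<le> \<tau>"
  shows "hardy k \<tau> = (\<integral>\<^sup>+ s\<in>{\<tau><..<1}. k s \<partial>lebesgue)"
  unfolding hardy_def nn_integral_leb01 using assms by (intro nn_integral_cong) (auto simp: indicator_def)

context hardy_weight
begin

lemma opt_norm_cong:
  assumes "u \<in> borel_measurable leb01" "v \<in> borel_measurable leb01" "AE x in leb01. u x = v x"
  shows "opt_norm u = opt_norm v"
  using assms by (intro antisym opt_norm_mono) (auto elim: eventually_mono)

text \<open>Definiteness comes from P5: a vanishing norm forces a vanishing integral.\<close>

lemma opt_norm_eq_0_iff:
  assumes u: "u \<in> borel_measurable leb01"
  shows "opt_norm u = 0 \<longleftrightarrow> (AE x in leb01. u x = 0)"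
proof
  assume "opt_norm u = 0"
  moreover obtain c where "(\<integral>\<^sup>+ x. u x \<partial>leb01) \<le> ennreal c * opt_norm u" using integral_le_opt_norm u by metis
  ultimately have "(\<integral>\<^sup>+ x. u x \<partial>leb01) = 0" by simp
  with u show "AE x in leb01. u x = 0" by (simp add: nn_integral_0_iff_AE)
next
  assume "AE x in leb01. u x = 0"
  then have "opt_norm u = opt_norm (\<lambda>x. 0 * 1)" using u by (intro opt_norm_cong) auto
  also have "\<dots> = 0" by (subst opt_norm_cmult) auto
  finally show "opt_norm u = 0" .
qed

lemma N_tail_integral:
  assumes w: "w = (\<lambda>s. 1 / ennreal (I s))" and h: "h \<in> M01_plus"
  shows "N (tail_integral I h) = hardy_norm (\<lambda>x. e2ennreal (h x))"
  unfolding hardy_norm_def ennorm_def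
proof (rule N_cong[symmetric])
  have m: "(\<lambda>x. e2ennreal (h x)) \<in> borel_measurable leb01" using h by (rule e2ennreal_measurable_M01_plus)
  show "(\<lambda>x. enn2ereal (hardy (\<lambda>s. e2ennreal (h s) * w s) x)) \<in> M01_plus"
    by (intro enn2ereal_in_M01_plus hardy_weighted_measurable m)
  fix x :: real assume "x \<in> {0<..<1}"
  then show "enn2ereal (hardy (\<lambda>s. e2ennreal (h s) * w s) x) = tail_integral I h x"
    unfolding tail_integral_def w by (simp add: hardy_eq_lebesgue ennreal_times_divide)
qed

lemma X_norm_eq:
  assumes w: "w = (\<lambda>s. 1 / ennreal (I s))" and f: "f \<in> M01_plus"
  shows "X_norm N I f = opt_norm (\<lambda>x. e2ennreal (f x))"
proof (rule antisym)
  have fm: "(\<lambda>x. e2ennreal (f x)) \<in> borel_measurable leb01" using f by (rule e2ennreal_measurable_M01_plus)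
  have fM: "f \<in> M01" using f by (simp add: M01_plus_def)
  show "opt_norm (\<lambda>x. e2ennreal (f x)) \<le> X_norm N I f"
    unfolding opt_norm_def
  proof (rule SUP_least)
    fix \<theta> assume \<theta>: "\<theta> \<in> mpres"
    have "N (tail_integral I (\<lambda>x. f (\<theta> x))) \<le> X_norm N I f"
      unfolding X_norm_def using M01_plus_comp_mpres[OF f \<theta>] same_rearr_comp_mpres[OF fM \<theta>]
      by (intro SUP_upper) auto
    then show "hardy_norm (\<lambda>x. e2ennreal (f (\<theta> x))) \<le> X_norm N I f"
      by (simp add: N_tail_integral[OF w M01_plus_comp_mpres[OF f \<theta>]])
  qed
  show "X_norm N I f \<le> opt_norm (\<lambda>x. e2ennreal (f x))"
    unfolding X_norm_def
  proof (rule SUP_least)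
    fix h assume "h \<in> {h \<in> M01_plus. same_rearr h f}"
    then have h: "h \<in> M01_plus" "same_rearr h f" by auto
    have hm: "(\<lambda>x. e2ennreal (h x)) \<in> borel_measurable leb01" using h(1) by (rule e2ennreal_measurable_M01_plus)
    have le: "hardy_norm (\<lambda>x. e2ennreal (h x)) \<le> ennreal b * opt_norm (\<lambda>x. e2ennreal (f x))" if b: "1 < b" for b
    proof -
      obtain \<theta> where \<theta>: "\<theta> \<in> mpres" and le: "AE x in leb01. h x \<le> ereal b * f (\<theta> x)"
        using same_rearr_obtain_mpres[OF f h(1,2) b] .
      have nn: "AE x in leb01. 0 \<le> f (\<theta> x)" using M01_plus_comp_mpres[OF f \<theta>] by (simp add: M01_plus_def)
      have "AE x in leb01. e2ennreal (h x) \<le> ennreal b * e2ennreal (f (\<theta> x))"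
        using le nn
      proof eventually_elim
        case (elim x)
        then show ?case using b e2ennreal_mono[OF elim(1)] by (simp add: e2ennreal_mult)
      qed
      then have "hardy_norm (\<lambda>x. e2ennreal (h x)) \<le> hardy_norm (\<lambda>x. ennreal b * e2ennreal (f (\<theta> x)))"
        using hm comp_measurable[OF fm \<theta>] by (intro hardy_norm_mono) auto
      also have "\<dots> = ennreal b * hardy_norm (\<lambda>x. e2ennreal (f (\<theta> x)))"
        by (rule hardy_norm_cmult[OF comp_measurable[OF fm \<theta>]])
      also have "\<dots> \<le> ennreal b * opt_norm (\<lambda>x. e2ennreal (f x))"
        by (intro mult_left_mono opt_norm_upper[OF \<theta>, of "\<lambda>x. e2ennreal (f x)"]) simp
      finally show ?thesis .
    qed
    have "hardy_norm (\<lambda>x. e2ennreal (h x)) \<le> opt_norm (\<lambda>x. e2ennreal (f x))"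
    proof (cases "opt_norm (\<lambda>x. e2ennreal (f x))")
      case (real r)
      show ?thesis
      proof (rule ennreal_le_epsilon)
        fix e :: real assume e: "0 < e"
        \<comment> \<open>The factor b = 1 + e/(r+1) adds less than e to r; the 1 in the denominator
          covers r = 0.\<close>
        have "(1 + e / (r + 1)) * r \<le> r + e" using real(1) e by (simp add: field_simps)
        then have "ennreal (1 + e / (r + 1)) * ennreal r \<le> ennreal (r + e)"
          using real(1) e by (subst ennreal_mult[symmetric]) (auto simp del: ennreal_plus intro: ennreal_leI)
        with le[of "1 + e / (r + 1)"] real e
        show "hardy_norm (\<lambda>x. e2ennreal (h x)) \<le> opt_norm (\<lambda>x. e2ennreal (f x)) + ennreal e"
          by (auto simp: ennreal_plus intro: order_trans)
      qed
    qed simp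
    then show "N (tail_integral I h) \<le> opt_norm (\<lambda>x. e2ennreal (f x))"
      by (simp add: N_tail_integral[OF w h(1)])
  qed
qed

lemma ri_function_norm_X_norm:
  assumes w: "w = (\<lambda>s. 1 / ennreal (I s))"
  shows "ri_function_norm (X_norm N I)"
proof
  note em = e2ennreal_measurable_M01_plus
  have nn: "AE x in leb01. 0 \<le> f x" and fm: "f \<in> borel_measurable leb01" if "f \<in> M01_plus" for f
    using that by (auto simp: M01_plus_def M01_def)
  show "X_norm N I (\<lambda>x. 1) < \<infinity>"
  proof -
    have one: "(\<lambda>x. 1) \<in> M01_plus" by (simp add: M01_plus_def M01_def)
    have "e2ennreal 1 = 1" by (simp add: one_ereal_def)
    then show ?thesis using opt_norm_one by (simp add: X_norm_eq[OF w one])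
  qed
  show "\<exists>c::real. 0 < c \<and> (\<forall>f\<in>M01_plus. (\<integral>\<^sup>+ x. e2ennreal (f x) \<partial>leb01) \<le> ennreal c * X_norm N I f)"
  proof -
    obtain c where "0 < c" "\<And>u. u \<in> borel_measurable leb01 \<Longrightarrow> (\<integral>\<^sup>+ x. u x \<partial>leb01) \<le> ennreal c * opt_norm u"
      using integral_le_opt_norm by metis
    then show ?thesis by (intro exI[of _ c]) (simp add: X_norm_eq[OF w] em)
  qed
  fix f g assume f: "f \<in> M01_plus"
  show "X_norm N I f = 0 \<longleftrightarrow> (AE x in leb01. f x = 0)"
  proof -
    have "(AE x in leb01. e2ennreal (f x) = 0) \<longleftrightarrow> (AE x in leb01. f x = 0)"
    proof
      assume "AE x in leb01. e2ennreal (f x) = 0"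
      with nn[OF f] show "AE x in leb01. f x = 0"
        by eventually_elim (metis enn2ereal_e2ennreal zero_ennreal.rep_eq)
    next
      assume "AE x in leb01. f x = 0"
      then show "AE x in leb01. e2ennreal (f x) = 0" by eventually_elim (simp add: e2ennreal_neg)
    qed
    then show ?thesis by (simp add: X_norm_eq[OF w f] opt_norm_eq_0_iff em[OF f])
  qed
  show "X_norm N I (\<lambda>x. ereal c * f x) = ennreal c * X_norm N I f" if c: "0 \<le> c" for c
  proof -
    have cf: "(\<lambda>x. ereal c * f x) \<in> M01_plus"
      using nn[OF f] fm[OF f] c unfolding M01_plus_def M01_def by (auto elim!: eventually_mono)
    have "AE x in leb01. e2ennreal (ereal c * f x) = ennreal c * e2ennreal (f x)"
      using nn[OF f] by eventually_elim (simp add: e2ennreal_mult c)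
    then have "opt_norm (\<lambda>x. e2ennreal (ereal c * f x)) = opt_norm (\<lambda>x. ennreal c * e2ennreal (f x))"
      using em[OF cf] em[OF f] by (intro opt_norm_cong) auto
    then show ?thesis by (simp add: X_norm_eq[OF w cf] X_norm_eq[OF w f] opt_norm_cmult em[OF f])
  qed
  show "X_norm N I f \<le> X_norm N I g" if g: "g \<in> M01_plus" and le: "AE x in leb01. f x \<le> g x"
  proof -
    have "AE x in leb01. e2ennreal (f x) \<le> e2ennreal (g x)"
      using le by eventually_elim (simp add: e2ennreal_mono)
    then show ?thesis by (simp add: X_norm_eq[OF w] f g opt_norm_mono em)
  qed
  show "X_norm N I (\<lambda>x. f x + g x) \<le> X_norm N I f + X_norm N I g" if g: "g \<in> M01_plus"
  proof -
    have "AE x in leb01. 0 \<le> f x + g x" using nn[OF f] nn[OF g] by eventually_elim simp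
    then have fg: "(\<lambda>x. f x + g x) \<in> M01_plus"
      using fm[OF f] fm[OF g] unfolding M01_plus_def M01_def by auto
    have "AE x in leb01. e2ennreal (f x + g x) = e2ennreal (f x) + e2ennreal (g x)"
      using nn[OF f] nn[OF g] by eventually_elim (simp add: e2ennreal_add)
    then have "opt_norm (\<lambda>x. e2ennreal (f x + g x)) = opt_norm (\<lambda>x. e2ennreal (f x) + e2ennreal (g x))"
      using em[OF fg] em[OF f] em[OF g] by (intro opt_norm_cong) auto
    also have "\<dots> \<le> opt_norm (\<lambda>x. e2ennreal (f x)) + opt_norm (\<lambda>x. e2ennreal (g x))"
      by (rule opt_norm_add[OF em[OF f] em[OF g]])
    finally show ?thesis by (simp add: X_norm_eq[OF w] f g fg)
  qed
  \<comment> \<open>The set of competitors h depends on f only through f*, so P6 holds by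
    definition.\<close>
  show "X_norm N I f = X_norm N I g" if "same_rearr f g"
    using that by (simp add: X_norm_def same_rearr_def)
  fix F :: "nat \<Rightarrow> real \<Rightarrow> ereal"
  assume F: "\<And>j. F j \<in> M01_plus" and lim: "AE x in leb01. incseq (\<lambda>j. F j x) \<and> (\<lambda>j. F j x) \<longlonglongrightarrow> f x"
  have 1: "AE x in leb01. incseq (\<lambda>j. e2ennreal (F j x)) \<and> e2ennreal (f x) = (SUP j. e2ennreal (F j x))"
    using lim
  proof eventually_elim
    case (elim x)
    then have inc: "incseq (\<lambda>j. e2ennreal (F j x))" by (auto simp: incseq_def intro: e2ennreal_mono)
    have "(\<lambda>j. e2ennreal (F j x)) \<longlonglongrightarrow> e2ennreal (f x)" using elim by (intro tendsto_e2ennrealI) simp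
    with LIMSEQ_SUP[OF inc] inc show ?case using LIMSEQ_unique by blast
  qed
  have sup: "X_norm N I f = (SUP j. X_norm N I (F j))"
    using opt_norm_SUP[OF em[OF F] em[OF f] 1] by (simp add: X_norm_eq[OF w] f F)
  have inc: "incseq (\<lambda>j. X_norm N I (F j))"
  proof (rule incseq_SucI)
    fix j
    have "AE x in leb01. e2ennreal (F j x) \<le> e2ennreal (F (Suc j) x)"
      using 1 by eventually_elim (auto simp: incseq_Suc_iff)
    then show "X_norm N I (F j) \<le> X_norm N I (F (Suc j))"
      by (simp add: X_norm_eq[OF w] F opt_norm_mono em)
  qed
  show "incseq (\<lambda>j. X_norm N I (F j)) \<and> (\<lambda>j. X_norm N I (F j)) \<longlonglongrightarrow> X_norm N I f"
    using inc LIMSEQ_SUP[OF inc] by (simp add: sup)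
qed

text \<open>The extension rule for signed f follows because f and f* have the same competitors
  h.\<close>

lemma ri_space_X_norm:
  assumes w: "w = (\<lambda>s. 1 / ennreal (I s))"
  shows "ri_space {f \<in> M01. X_norm N I f < \<infinity>} (X_norm N I)"
proof -
  have "X_norm N I f = X_norm N I (rearr f)" if "f \<in> M01" for f
    using same_rearr_rearr[OF that] by (simp add: X_norm_def same_rearr_def)
  then show ?thesis unfolding ri_space_def using ri_function_norm_X_norm[OF w] by blast
qed

section \<open>Two-sided bounds for the fundamental function\<close>

lemma fundamental_X_norm:
  assumes w: "w = (\<lambda>s. 1 / ennreal (I s))" and F: "F \<in> sets leb01"
  shows "fundamental_function (X_norm N I) (measure leb01 F) = opt_norm (indicator F)"
proof -
  have "(\<lambda>x. enn2ereal (indicator F x)) \<in> M01_plus" using F by (intro enn2ereal_in_M01_plus) auto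
  then have i: "indicator F \<in> M01_plus" by (simp add: enn2ereal_indicator)
  have "(\<lambda>x. e2ennreal (indicator F x)) = indicator F"
    by (rule ext) (simp only: enn2ereal_indicator[symmetric] e2ennreal_enn2ereal)
  then show ?thesis
    using ri_function_norm.fundamental_function_eq[OF ri_function_norm_X_norm[OF w] F refl] X_norm_eq[OF w i]
    by simp
qed

lemma opt_norm_indicator_le:
  assumes E: "E \<in> sets leb01" "measure leb01 E = t"
  shows "opt_norm (indicator E) \<le> (\<integral>\<^sup>+ s\<in>{0<..<t}. (SUP \<tau>\<in>{s<..<1}. \<phi> \<tau> * w \<tau>) \<partial>lebesgue)"
proof -
  interpret finite_measure leb01 by (rule finite_measure_leb01)
  let ?G = "\<lambda>s. SUP \<tau>\<in>{s<..<1}. \<phi> \<tau> * w \<tau>"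
  have t: "0 \<le> t" "t \<le> 1"
    using bounded_measure[of E] E(2) by (auto simp: measure_def space_leb01 emeasure_space_leb01)
  have G: "antimono ?G" by (rule antimonoI) (auto intro!: SUP_subset_mono)
  show ?thesis
    unfolding opt_norm_def
  proof (rule SUP_least)
    fix \<theta> assume \<theta>: "\<theta> \<in> mpres"
    \<comment> \<open>Composing the indicator of E with \<theta> gives the indicator of a preimage,
      again of measure t.\<close>
    let ?F = "{x \<in> {0<..<1}. \<theta> x \<in> E}"
    have F: "?F \<in> sets leb01" "measure leb01 ?F = t"
      using measurable_sets[OF mpres_measurable[OF \<theta>] E(1)] mpres_emeasure[OF \<theta> E(1)] E(2)
      by (auto simp: vimage_def space_leb01 Int_def conj_commute measure_def)
    have k: "(\<lambda>s. indicator E (\<theta> s) * w s) \<in> borel_measurable leb01"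
      using comp_measurable[OF _ \<theta>, of "indicator E"] E(1) by (intro weighted_measurable) auto
    \<comment> \<open>The pointwise bound of \<phi> w by its supremum to the right can fail where w
      jumps down; this happens at countably many points only.\<close>
    have "AE s in lebesgue. s \<notin> {s. s < 1 \<and> ?G s < \<phi> s * w s}"
      by (intro AE_not_in null_sets_completionI countable_imp_null_set_lborel countable_exceeds_right_sup)
    then have ae: "AE s in leb01. \<phi> s * w s \<le> ?G s"
      unfolding AE_leb01_iff by eventually_elim auto
    have "hardy_norm (\<lambda>x. indicator E (\<theta> x)) \<le> (\<integral>\<^sup>+ s. indicator E (\<theta> s) * w s * \<phi> s \<partial>leb01)"
      unfolding hardy_norm_def by (rule norm_hardy_le[OF k])
    also have "\<dots> \<le> (\<integral>\<^sup>+ s. ?G s * indicator ?F s \<partial>leb01)"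
    proof (rule nn_integral_mono_AE)
      show "AE s in leb01. indicator E (\<theta> s) * w s * \<phi> s \<le> ?G s * indicator ?F s"
        using ae AE_space by eventually_elim (auto simp: indicator_def mult.commute space_leb01)
    qed
    also have "\<dots> \<le> (\<integral>\<^sup>+ s. ?G s * indicator {0<..<t} s \<partial>leb01)"
      by (rule nn_integral_antimono_le_initial[OF G F t])
    also have "\<dots> = (\<integral>\<^sup>+ s\<in>{0<..<t}. ?G s \<partial>lebesgue)"
      using t by (intro set_integral_leb01) auto
    finally show "hardy_norm (\<lambda>x. indicator E (\<theta> x)) \<le> (\<integral>\<^sup>+ s\<in>{0<..<t}. ?G s \<partial>lebesgue)" .
  qed
qed

lemma opt_norm_indicator_ge:
  assumes anti: "\<And>x y. 0 < x \<Longrightarrow> x \<le> y \<Longrightarrow> y < 1 \<Longrightarrow> w y \<le> w x"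
    and ts: "0 < t" "t < s" "s < 1"
  obtains F where "F \<in> sets leb01" "measure leb01 F = t"
    "ennreal t * (\<phi> (s / 2) / ennreal s * (\<integral>\<^sup>+ \<tau>\<in>{s / 2<..<s}. w \<tau> \<partial>lebesgue)) \<le> opt_norm (indicator F)"
proof -
  let ?W = "\<integral>\<^sup>+ \<tau>\<in>{s / 2<..<s}. w \<tau> \<partial>lebesgue"
  \<comment> \<open>The test set must stay inside (0,s) and carry a share of at least t/s of the
    integral of w over (s/2,s). If t < s/2 it starts at s/2, where a non-increasing w is largest on
    that interval; otherwise it ends at s and contains the whole interval.\<close>
  define a where "a = min (s / 2) (s - t)"
  let ?F = "{a<..<a + t}"
  have sub: "?F \<subseteq> {0<..<1}" using ts by (auto simp: a_def)
  then have F: "?F \<in> sets leb01" "measure leb01 ?F = t"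
    using ts by (simp_all only: sets_leb01_iff measure_leb01) auto
  have h: "hardy (\<lambda>s. indicator ?F s * w s) (s / 2) = (\<integral>\<^sup>+ x. w x * indicator {s / 2<..<a + t} x \<partial>leb01)"
    unfolding hardy_def by (intro nn_integral_cong) (auto simp: indicator_def a_def)
  have W: "?W = (\<integral>\<^sup>+ x. w x * indicator {s / 2<..<s} x \<partial>leb01)"
    using ts by (intro set_integral_leb01[symmetric]) auto
  have main: "ennreal t * ?W \<le> ennreal s * hardy (\<lambda>s. indicator ?F s * w s) (s / 2)"
  proof (cases "t < s / 2")
    case True
    then have "ennreal (s / 2 + t - s / 2) * ?W \<le> ennreal (s - s / 2) * hardy (\<lambda>s. indicator ?F s * w s) (s / 2)"
      using antimono_integral_average[OF w_measurable anti, of "s / 2" "s / 2 + t" s] ts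
      unfolding h W by (simp add: a_def)
    \<comment> \<open>For small t the share is even 2t/s. The factor 2 is given away so that both
      cases end in the same bound.\<close>
    also have "\<dots> \<le> ennreal s * hardy (\<lambda>s. indicator ?F s * w s) (s / 2)"
      using ts by (intro mult_right_mono ennreal_leI) auto
    finally show ?thesis by simp
  next
    case False
    then have "a + t = s" by (simp add: a_def)
    then show ?thesis unfolding h W using ts by (simp add: mult_right_mono ennreal_leI)
  qed
  have "ennreal t * (\<phi> (s / 2) / ennreal s * ?W) = \<phi> (s / 2) * ennreal (1 / s) * (ennreal t * ?W)"
    using ts by (simp add: divide_ennreal_def inverse_ennreal inverse_eq_divide mult_ac)
  also have "\<dots> \<le> \<phi> (s / 2) * ennreal (1 / s) * (ennreal s * hardy (\<lambda>s. indicator ?F s * w s) (s / 2))"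
    using main by (rule mult_left_mono) simp
  also have "\<dots> = \<phi> (s / 2) * (ennreal (1 / s) * ennreal s) * hardy (\<lambda>s. indicator ?F s * w s) (s / 2)"
    by (simp only: mult_ac)
  also have "ennreal (1 / s) * ennreal s = 1"
    using ts by (subst ennreal_mult[symmetric]) auto
  also have "\<phi> (s / 2) * 1 * hardy (\<lambda>s. indicator ?F s * w s) (s / 2) \<le> hardy_norm (indicator ?F)"
    unfolding hardy_norm_def using ts F(1) norm_hardy_ge[OF weighted_measurable[of "indicator ?F"], of "s / 2"] by simp
  also have "\<dots> \<le> opt_norm (indicator ?F)"
    by (rule opt_norm_upper[OF mpres_id])
  finally show thesis by (rule that[OF F])
qed

end

theorem theorem3p1:
  fixes Y :: "(real \<Rightarrow> ereal) set"
    and NY :: "(real \<Rightarrow> ereal) \<Rightarrow> ennreal"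
    and I :: "real \<Rightarrow> real"
    and C :: real
  assumes "ri_space Y NY"
    and "\<forall>s\<in>{0..1}. 0 \<le> I s"
    and "mono_on {0..1} I"
    and "I \<in> borel_measurable (lebesgue_on {0..1})"
    and "(\<lambda>t. enn2ereal (\<integral>\<^sup>+ s\<in>{t<..<1}. 1 / ennreal (I s) \<partial>lebesgue)) \<in> Y"
    and "(fundamental_function NY \<longlongrightarrow> 0) (at_right 0)"
    and "0 < C"
    and "\<forall>t\<in>{0<..<1}.
      (\<integral>\<^sup>+ s\<in>{0<..<t}. (SUP \<tau>\<in>{s<..<1}. fundamental_function NY \<tau> / ennreal (I \<tau>)) \<partial>lebesgue)
      \<le> ennreal C * ennreal t *
        (SUP s\<in>{t<..<1}. fundamental_function NY (s / 2) / ennreal s *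
           (\<integral>\<^sup>+ \<tau>\<in>{s / 2<..<s}. 1 / ennreal (I \<tau>) \<partial>lebesgue))"
  shows "ri_space {f \<in> M01. X_norm NY I f < \<infinity>} (X_norm NY I) \<and>
    (\<exists>c1 c2 :: real. 0 < c1 \<and> 0 < c2 \<and>
      (\<forall>t\<in>{0<..<1}.
        ennreal c1 * ennreal t *
          (SUP s\<in>{t<..<1}. fundamental_function NY (s / 2) / ennreal s *
             (\<integral>\<^sup>+ \<tau>\<in>{s / 2<..<s}. 1 / ennreal (I \<tau>) \<partial>lebesgue))
        \<le> fundamental_function (X_norm NY I) t \<and>
        fundamental_function (X_norm NY I) t
        \<le> ennreal c2 * ennreal t *
          (SUP s\<in>{t<..<1}. fundamental_function NY (s / 2) / ennreal s *
             (\<integral>\<^sup>+ \<tau>\<in>{s / 2<..<s}. 1 / ennreal (I \<tau>) \<partial>lebesgue))))"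
proof -
  define w where "w = (\<lambda>s. 1 / ennreal (I s))"
  interpret Y: ri_function_norm NY using assms(1) by (simp add: ri_space_def)
  have I_nonneg: "0 \<le> I s" if "s \<in> {0..1}" for s using assms(2) that by blast
  have "I \<in> borel_measurable leb01"
    by (rule measurable_restrict_mono[OF assms(4)]) auto
  then have wm: "w \<in> borel_measurable leb01"
    unfolding w_def by measurable
  have anti: "w y \<le> w x" if "0 < x" "x \<le> y" "y < 1" for x y
  proof -
    have "I x \<le> I y" using that by (intro mono_onD[OF assms(3)]) auto
    then show ?thesis unfolding w_def using that I_nonneg by (intro inverse_ennreal_antimono) auto
  qed
  \<comment> \<open>The summand 1 keeps the denominator positive even if I vanishes at 1.\<close>
  have low: "ennreal (1 / (I 1 + 1)) \<le> w x" if "x \<in> {0<..<1}" for x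
  proof -
    have "I x \<le> I 1" using that by (intro mono_onD[OF assms(3)]) auto
    then have "1 / ennreal (I 1 + 1) \<le> w x"
      unfolding w_def using that I_nonneg by (intro inverse_ennreal_antimono) auto
    moreover have "1 / ennreal (I 1 + 1) = ennreal (1 / (I 1 + 1))"
      using I_nonneg[of 1] divide_ennreal[of 1 "I 1 + 1"] by simp
    ultimately show ?thesis by simp
  qed
  \<comment> \<open>Membership of the tail integral of 1/I in Y becomes the finiteness assumption of
    \<open>hardy_weight\<close>.\<close>
  have "Y.ennorm (hardy w) = NY (\<lambda>t. enn2ereal (\<integral>\<^sup>+ s\<in>{t<..<1}. 1 / ennreal (I s) \<partial>lebesgue))"
    unfolding Y.ennorm_def
  proof (rule Y.N_cong)
    show "(\<lambda>x. enn2ereal (hardy w x)) \<in> M01_plus"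
      by (intro enn2ereal_in_M01_plus hardy_measurable wm)
  qed (simp add: hardy_eq_lebesgue w_def)
  also have "\<dots> < \<infinity>" using assms(1,5) by (auto simp: ri_space_def)
  finally have fin: "Y.ennorm (hardy w) < \<infinity>" .
  interpret hardy_weight NY w "1 / (I 1 + 1)"
    using wm low fin I_nonneg[of 1] by unfold_locales auto
  let ?S = "\<lambda>t. SUP s\<in>{t<..<1}. fundamental_function NY (s / 2) / ennreal s *
             (\<integral>\<^sup>+ \<tau>\<in>{s / 2<..<s}. 1 / ennreal (I \<tau>) \<partial>lebesgue)"
  have lower: "ennreal 1 * ennreal t * ?S t \<le> fundamental_function (X_norm NY I) t"
    if t: "t \<in> {0<..<1}" for t
  proof -
    have "ennreal t * (fundamental_function NY (s / 2) / ennreal s *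
        (\<integral>\<^sup>+ \<tau>\<in>{s / 2<..<s}. 1 / ennreal (I \<tau>) \<partial>lebesgue)) \<le> fundamental_function (X_norm NY I) t"
      if s: "s \<in> {t<..<1}" for s
    proof -
      obtain F where "F \<in> sets leb01" "measure leb01 F = t"
        "ennreal t * (fundamental_function NY (s / 2) / ennreal s * (\<integral>\<^sup>+ \<tau>\<in>{s / 2<..<s}. w \<tau> \<partial>lebesgue)) \<le> opt_norm (indicator F)"
        using opt_norm_indicator_ge[OF anti, of t s] t s by auto
      then show ?thesis using fundamental_X_norm[OF w_def, of F] by (simp add: w_def)
    qed
    moreover have "{t<..<1} \<noteq> {}" using t by simp
    ultimately show ?thesis by (auto simp: SUP_mult_left_ennreal intro!: SUP_least)
  qed
  have upper: "fundamental_function (X_norm NY I) t \<le> ennreal C * ennreal t * ?S t"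
    if t: "t \<in> {0<..<1}" for t
  proof -
    have F: "{0<..<t} \<in> sets leb01" "measure leb01 {0<..<t} = t"
      using t by (auto intro!: Y.initial_interval)
    have "fundamental_function (X_norm NY I) t = opt_norm (indicator {0<..<t})"
      using fundamental_X_norm[OF w_def F(1)] F(2) by simp
    also have "\<dots> \<le> (\<integral>\<^sup>+ s\<in>{0<..<t}. (SUP \<tau>\<in>{s<..<1}. fundamental_function NY \<tau> * w \<tau>) \<partial>lebesgue)"
      using F by (rule opt_norm_indicator_le)
    also have "\<dots> = (\<integral>\<^sup>+ s\<in>{0<..<t}. (SUP \<tau>\<in>{s<..<1}. fundamental_function NY \<tau> / ennreal (I \<tau>)) \<partial>lebesgue)"
      by (simp add: w_def ennreal_times_divide)
    \<comment> \<open>Everything before this holds with constant 1, so the assumed inequality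
      supplies c2 = C.\<close>
    also have "\<dots> \<le> ennreal C * ennreal t * ?S t" using assms(8) t by blast
    finally show ?thesis .
  qed
  show ?thesis
    using ri_space_X_norm[OF w_def] lower upper \<open>0 < C\<close>
    by (intro conjI exI[of _ 1] exI[of _ C]) auto
qed

end
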